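(* Let $\alpha:I\to N^n\subset M^{m+1}$ be a regular curve in a submanifold $N^n$ of a Riemannian manifold $M^{m+1}$, and let $\{\mathbf t,\mathbf n_1,\dots,\mathbf n_m\}$ be a rotation minimizing frame along it. If $\alpha$ lies on a totally geodesic submanifold $N$, then its normal development curve $(\kappa_1,\dots,\kappa_m)$ lies on a line passing through the origin.
   Context: Curves are parametrized by arc-length. A rotation minimizing frame along $\alpha$ is an orthonormal frame $\{\mathbf t,\mathbf n_1,\dots,\mathbf n_m\}$ of $TM$ along $\alpha$ with $\mathbf t=\alpha'$ and $\nabla_{\mathbf t}\mathbf n_i=-\kappa_i\mathbf t$, where $\nabla$ is the Levi-Civita connection of $M$; then $\nabla_{\mathbf t}\mathbf t=\sum_i\kappa_i\mathbf n_i$. The curve $(\kappa_1,\dots,\kappa_m)$ in $\mathbb{R}^m$ is the normal development of $\alpha$. A submanifold $N\subset M$ is totally geodesic if every geodesic of $N$ with the induced Riemannian metric is also a geodesic of $M$.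
   Formalization: The claim fails for n ≥ 3 (a helix in R^3 inside R^4), so it is proved that the normal development lies on a line through the origin when n ≤ 2, and on a hyperplane through the origin when n ≤ m. *)

theory Defs
  imports "HOL-Analysis.Analysis"
begin

section \<open>Smooth maps between open subsets of Euclidean spaces\<close>

primrec Ck_on :: "nat \<Rightarrow> 'a::real_normed_vector set \<Rightarrow> ('a \<Rightarrow> 'b::real_normed_vector) \<Rightarrow> bool"
  where
    "Ck_on 0 S f \<longleftrightarrow> continuous_on S f"
  | "Ck_on (Suc k) S f \<longleftrightarrow>
       (\<forall>x\<in>S. f differentiable (at x)) \<and> (\<forall>v. Ck_on k S (\<lambda>x. frechet_derivative f (at x) v))"

text \<open>The domain \<open>S\<close> is open in all uses below.\<close>

definition smooth_map_on :: "'a::real_normed_vector set \<Rightarrow> ('a \<Rightarrow> 'b::real_normed_vector) \<Rightarrow> bool"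
  where "smooth_map_on S f \<longleftrightarrow> (\<forall>k. Ck_on k S f)"


section \<open>Riemannian manifolds\<close>

text \<open>
  A chart is a pair of its domain and its coordinate map. A manifold of dimension \<open>DIM('e)\<close> is
  modelled on \<open>'e\<close>; its points form the carrier of a topology on a subset of \<open>'a\<close>. The metric is
  given by its local expressions: \<open>local_metric X c x u v\<close> is the inner product, at the point
  with coordinates \<open>x\<close> in the chart \<open>c\<close>, of the tangent vectors with components \<open>u\<close>, \<open>v\<close> in \<open>c\<close>.
  The atlas need not be maximal: no notion below changes when compatible charts are added.
\<close>

type_synonym ('a, 'e) chart = "'a set \<times> ('a \<Rightarrow> 'e)"

record ('a, 'e) riem =
  mtop :: "'a topology"
  atlas :: "('a, 'e) chart set"
  local_metric :: "('a, 'e) chart \<Rightarrow> 'e \<Rightarrow> 'e \<Rightarrow> 'e \<Rightarrow> real"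

definition topological_chart :: "'a topology \<Rightarrow> ('a, 'e::euclidean_space) chart \<Rightarrow> bool"
  where "topological_chart T c \<longleftrightarrow>
    openin T (fst c) \<and> open (snd c ` fst c) \<and>
    homeomorphic_map (subtopology T (fst c)) (top_of_set (snd c ` fst c)) (snd c)"

text \<open>
  The identity of points read in the charts \<open>c\<close> (source) and \<open>d\<close> (target), which may belong to
  different manifolds. It serves both as the change of coordinates and as the local expression of
  the inclusion of a submanifold.
\<close>

definition transition :: "('a, 'e) chart \<Rightarrow> ('a, 'f) chart \<Rightarrow> 'e \<Rightarrow> 'f"
  where "transition c d x = snd d (inv_into (fst c) (snd c) x)"

definition transition_dom :: "('a, 'e) chart \<Rightarrow> ('a, 'f) chart \<Rightarrow> 'e set"
  where "transition_dom c d = snd c ` (fst c \<inter> fst d)"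

definition transition_deriv ::
  "('a, 'e::real_normed_vector) chart \<Rightarrow> ('a, 'f::real_normed_vector) chart \<Rightarrow> 'e \<Rightarrow> 'e \<Rightarrow> 'f"
  where "transition_deriv c d x = frechet_derivative (transition c d) (at x)"

definition smooth_manifold :: "('a, 'e::euclidean_space) riem \<Rightarrow> bool"
  where "smooth_manifold X \<longleftrightarrow>
    Hausdorff_space (mtop X) \<and> second_countable (mtop X) \<and>
    (\<forall>c\<in>atlas X. topological_chart (mtop X) c) \<and>
    (\<Union>c\<in>atlas X. fst c) = topspace (mtop X) \<and>
    (\<forall>c\<in>atlas X. \<forall>d\<in>atlas X. smooth_map_on (transition_dom c d) (transition c d))"

definition riemannian_metric :: "('a, 'e::euclidean_space) riem \<Rightarrow> bool"
  where "riemannian_metric X \<longleftrightarrow>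
    (\<forall>c\<in>atlas X.
       (\<forall>u v. smooth_map_on (snd c ` fst c) (\<lambda>x. local_metric X c x u v)) \<and>
       (\<forall>x\<in>snd c ` fst c.
          bilinear (local_metric X c x) \<and>
          (\<forall>u v. local_metric X c x u v = local_metric X c x v u) \<and>
          (\<forall>u. u \<noteq> 0 \<longrightarrow> 0 < local_metric X c x u u))) \<and>
    (\<forall>c\<in>atlas X. \<forall>d\<in>atlas X. \<forall>x\<in>transition_dom c d. \<forall>u v.
       local_metric X d (transition c d x) (transition_deriv c d x u) (transition_deriv c d x v)
         = local_metric X c x u v)"

definition riemannian_manifold :: "('a, 'e::euclidean_space) riem \<Rightarrow> bool"
  where "riemannian_manifold X \<longleftrightarrow> smooth_manifold X \<and> riemannian_metric X"


section \<open>Tangent vectors and the Levi-Civita connection\<close>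

text \<open>
  A tangent vector at \<open>p\<close> is the family of its components in the charts around \<open>p\<close>, which
  transform by the derivative of the change of coordinates; components in other charts are
  irrelevant.
\<close>

type_synonym ('a, 'e) tvec = "('a, 'e) chart \<Rightarrow> 'e"

definition tangent_vector :: "('a, 'e::euclidean_space) riem \<Rightarrow> 'a \<Rightarrow> ('a, 'e) tvec \<Rightarrow> bool"
  where "tangent_vector X p v \<longleftrightarrow>
    (\<forall>c\<in>atlas X. \<forall>d\<in>atlas X. p \<in> fst c \<inter> fst d \<longrightarrow>
       v d = transition_deriv c d (snd c p) (v c))"

definition has_inner :: "('a, 'e) riem \<Rightarrow> 'a \<Rightarrow> ('a, 'e) tvec \<Rightarrow> ('a, 'e) tvec \<Rightarrow> real \<Rightarrow> bool"
  where "has_inner X p v w r \<longleftrightarrow>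
    (\<forall>c\<in>atlas X. p \<in> fst c \<longrightarrow> local_metric X c (snd c p) (v c) (w c) = r)"

text \<open>
  The Levi-Civita connection in a chart: \<open>christoffel X c x u v\<close> is the covariant derivative in
  direction \<open>u\<close> of the vector field with constant components \<open>v\<close>. It is determined by the Koszul
  formula, whose bracket terms vanish for fields with constant components.
\<close>

definition christoffel ::
  "('a, 'e::euclidean_space) riem \<Rightarrow> ('a, 'e) chart \<Rightarrow> 'e \<Rightarrow> 'e \<Rightarrow> 'e \<Rightarrow> 'e"
  where "christoffel X c x u v =
    (THE w. \<forall>z. 2 * local_metric X c x w z =
        frechet_derivative (\<lambda>y. local_metric X c y v z) (at x) u
      + frechet_derivative (\<lambda>y. local_metric X c y u z) (at x) v
      - frechet_derivative (\<lambda>y. local_metric X c y u v) (at x) z)"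


section \<open>Curves\<close>

definition nondegenerate_interval :: "real set \<Rightarrow> bool"
  where "nondegenerate_interval I \<longleftrightarrow> is_interval I \<and> interior I \<noteq> {}"

text \<open>All derivatives are taken within \<open>I\<close>, hence are one-sided at endpoints belonging to \<open>I\<close>.\<close>

definition velocity :: "real set \<Rightarrow> (real \<Rightarrow> 'a) \<Rightarrow> real \<Rightarrow> ('a, 'e::real_normed_vector) tvec"
  where "velocity I \<gamma> s = (\<lambda>c. vector_derivative (\<lambda>r. snd c (\<gamma> r)) (at s within I))"

definition C2_curve :: "('a, 'e::euclidean_space) riem \<Rightarrow> real set \<Rightarrow> (real \<Rightarrow> 'a) \<Rightarrow> bool"
  where "C2_curve X I \<gamma> \<longleftrightarrow>
    nondegenerate_interval I \<and> continuous_map (top_of_set I) (mtop X) \<gamma> \<and>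
    (\<forall>c\<in>atlas X.
       (\<forall>s\<in>I. \<gamma> s \<in> fst c \<longrightarrow>
          (\<lambda>r. snd c (\<gamma> r)) differentiable (at s within I) \<and>
          (\<lambda>r. velocity I \<gamma> r c) differentiable (at s within I)) \<and>
       continuous_on {s\<in>I. \<gamma> s \<in> fst c}
         (\<lambda>s. vector_derivative (\<lambda>r. velocity I \<gamma> r c) (at s within I)))"

text \<open>
  \<open>has_covariant_derivative X I \<gamma> V W s\<close>: the vector field \<open>V\<close> along \<open>\<gamma>\<close> is differentiable at \<open>s\<close>
  and \<open>W\<close> is its Levi-Civita covariant derivative with respect to the velocity of \<open>\<gamma>\<close> there.
\<close>

definition has_covariant_derivative ::
  "('a, 'e::euclidean_space) riem \<Rightarrow> real set \<Rightarrow> (real \<Rightarrow> 'a) \<Rightarrow>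
   (real \<Rightarrow> ('a, 'e) tvec) \<Rightarrow> ('a, 'e) tvec \<Rightarrow> real \<Rightarrow> bool"
  where "has_covariant_derivative X I \<gamma> V W s \<longleftrightarrow>
    (\<forall>c\<in>atlas X. \<gamma> s \<in> fst c \<longrightarrow>
       (\<exists>D. ((\<lambda>r. V r c) has_vector_derivative D) (at s within I) \<and>
            W c = D + christoffel X c (snd c (\<gamma> s)) (velocity I \<gamma> s c) (V s c)))"

definition geodesic :: "('a, 'e::euclidean_space) riem \<Rightarrow> real set \<Rightarrow> (real \<Rightarrow> 'a) \<Rightarrow> bool"
  where "geodesic X I \<gamma> \<longleftrightarrow>
    C2_curve X I \<gamma> \<and>
    (\<forall>s\<in>I. has_covariant_derivative X I \<gamma> (velocity I \<gamma>) (\<lambda>c. 0) s)"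


section \<open>Submanifolds\<close>

text \<open>
  A submanifold carries its own topology and smooth structure, for which the inclusion is an
  immersion; embedded submanifolds are those with the subspace topology.
\<close>

definition submanifold ::
  "('a, 'n::euclidean_space) riem \<Rightarrow> ('a, 'e::euclidean_space) riem \<Rightarrow> bool"
  where "submanifold N M \<longleftrightarrow>
    smooth_manifold N \<and> smooth_manifold M \<and>
    topspace (mtop N) \<subseteq> topspace (mtop M) \<and>
    continuous_map (mtop N) (mtop M) (\<lambda>p. p) \<and>
    (\<forall>c\<in>atlas N. \<forall>d\<in>atlas M.
       smooth_map_on (transition_dom c d) (transition c d) \<and>
       (\<forall>x\<in>transition_dom c d. inj (transition_deriv c d x)))"

definition has_induced_metric ::
  "('a, 'n::euclidean_space) riem \<Rightarrow> ('a, 'e::euclidean_space) riem \<Rightarrow> bool"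
  where "has_induced_metric N M \<longleftrightarrow>
    (\<forall>c\<in>atlas N. \<forall>d\<in>atlas M. \<forall>x\<in>transition_dom c d. \<forall>u v.
       local_metric N c x u v =
         local_metric M d (transition c d x) (transition_deriv c d x u) (transition_deriv c d x v))"

definition riemannian_submanifold ::
  "('a, 'n::euclidean_space) riem \<Rightarrow> ('a, 'e::euclidean_space) riem \<Rightarrow> bool"
  where "riemannian_submanifold N M \<longleftrightarrow>
    riemannian_manifold N \<and> riemannian_manifold M \<and> submanifold N M \<and> has_induced_metric N M"

definition totally_geodesic ::
  "('a, 'n::euclidean_space) riem \<Rightarrow> ('a, 'e::euclidean_space) riem \<Rightarrow> bool"
  where "totally_geodesic N M \<longleftrightarrow>
    riemannian_submanifold N M \<and> (\<forall>J \<gamma>. geodesic N J \<gamma> \<longrightarrow> geodesic M J \<gamma>)"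


section \<open>Rotation minimizing frames\<close>

text \<open>
  \<open>nf i s\<close> is the normal vector with index \<open>i\<close> at \<open>\<gamma> s\<close>; the tangent vector of the frame is the
  velocity, so that orthonormality contains the parametrization by arc-length. The dimension
  condition makes the orthonormal system a frame. The curve \<open>\<kappa>\<close> is the normal development.
\<close>

definition rotation_minimizing_frame ::
  "('a, 'e::euclidean_space) riem \<Rightarrow> real set \<Rightarrow> (real \<Rightarrow> 'a) \<Rightarrow>
   ('m::finite \<Rightarrow> real \<Rightarrow> ('a, 'e) tvec) \<Rightarrow> (real \<Rightarrow> real ^ 'm) \<Rightarrow> bool"
  where "rotation_minimizing_frame M I \<gamma> nf \<kappa> \<longleftrightarrow>
    DIM('e) = CARD('m) + 1 \<and>
    (\<forall>s\<in>I.
       (\<forall>i. tangent_vector M (\<gamma> s) (nf i s)) \<and>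
       has_inner M (\<gamma> s) (velocity I \<gamma> s) (velocity I \<gamma> s) 1 \<and>
       (\<forall>i. has_inner M (\<gamma> s) (velocity I \<gamma> s) (nf i s) 0) \<and>
       (\<forall>i j. has_inner M (\<gamma> s) (nf i s) (nf j s) (if i = j then 1 else 0)) \<and>
       (\<forall>i. has_covariant_derivative M I \<gamma> (nf i) (\<lambda>c. - (\<kappa> s $ i) *\<^sub>R velocity I \<gamma> s c) s))"

end

theory Submission
  imports Defs
begin

text \<open>
  Let \<open>\<phi>\<close> be the inclusion \<open>N \<subseteq> M\<close> read in charts. Tangent vectors of \<open>N\<close> at \<open>\<alpha> s\<close> are the
  images \<open>D\<phi> u\<close>, and they have coordinates \<open>S s u = (\<langle>n\<^sub>i, D\<phi> u\<rangle>)\<^sub>i\<close> in \<open>\<real>\<^sup>m\<close> with respect to the normal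
  vectors of the frame. The idea is that the subspace \<open>range (S s)\<close> of \<open>\<real>\<^sup>m\<close> does not depend on \<open>s\<close>, that
  its dimension is at most \<open>n - 1\<close>, and that it contains the normal development. For a surface \<open>N\<close>
  it is contained in a line; for \<open>n \<le> m\<close> it is at least contained in a hyperplane.

  What makes this work is that the second fundamental form of a totally geodesic \<open>N\<close> vanishes
  (\<open>totally_geodesic_cov_hessian\<close>), so that the covariant derivative in \<open>M\<close> of a field tangent to \<open>N\<close>
  is the image of its covariant derivative in \<open>N\<close>. Three consequences follow.

  \<^item> The acceleration \<open>\<nabla>\<^sub>t t = \<Sum>\<^sub>i \<kappa>\<^sub>i n\<^sub>i\<close> is tangent to \<open>N\<close>, say equal to \<open>D\<phi> w\<close>, whence \<open>\<kappa> = S w\<close>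
    (\<open>normal_development_eq\<close>).
  \<^item> The velocity is tangent to \<open>N\<close> and orthogonal to all \<open>n\<^sub>i\<close>, so that \<open>S\<close> kills a nonzero vector.
  \<^item> Let \<open>a\<close> be a constant vector of \<open>\<real>\<^sup>m\<close>. Differentiating \<open>a \<bullet> S u\<close> along \<open>\<alpha>\<close> gives only terms
    linear in the values of \<open>a \<bullet> S\<close> on a basis (\<open>S_has_derivative_linear\<close>). By uniqueness for linear
    differential equations the orthogonal complement of \<open>range (S s)\<close> is locally constant in \<open>s\<close>, hence
    constant on the interval. In geometric terms, parallel transport in \<open>M\<close> along \<open>\<alpha>\<close> preserves the normal
    spaces of \<open>N\<close>.

  The definition of a totally geodesic submanifold speaks of geodesics only, and to make use of it one
  needs a geodesic of \<open>N\<close> with any prescribed initial velocity (\<open>geodesic_through\<close>). This rests on the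
  Picard-Lindelof theorem, and hence on local Lipschitz continuity of the Christoffel symbols. Geodesics
  show that the second fundamental form vanishes on the diagonal; as it is symmetric, by Schwarz's theorem
  on second derivatives, it vanishes altogether.
\<close>

section \<open>Symmetry of second derivatives\<close>

abbreviation dderiv :: "('a::real_normed_vector \<Rightarrow> 'b::real_normed_vector) \<Rightarrow> 'a \<Rightarrow> 'a \<Rightarrow> 'b"
  where "dderiv f v \<equiv> (\<lambda>x. frechet_derivative f (at x) v)"

lemma Ck_on_has_derivative:
  assumes "Ck_on (Suc k) S f" "x \<in> S"
  shows "(f has_derivative (\<lambda>v. dderiv f v x)) (at x)"
  using assms by (simp add: frechet_derivative_works[symmetric])

lemma Ck_on_dderiv: "Ck_on (Suc k) S f \<Longrightarrow> Ck_on k S (dderiv f v)"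
  by simp

lemma Ck_on_continuous: "Ck_on k S f \<Longrightarrow> continuous_on S f"
  by (cases k) (auto intro!: continuous_at_imp_continuous_on differentiable_imp_continuous_within)

lemma dderiv_linear:
  assumes "Ck_on (Suc k) S f" "x \<in> S"
  shows "linear (\<lambda>v. dderiv f v x)"
  using has_derivative_linear[OF Ck_on_has_derivative[OF assms]] .

text \<open>
  Two applications of the mean value theorem express the second difference of \<open>f\<close> over a parallelogram by a
  mixed second derivative at some point of it. The left-hand side is symmetric in \<open>u\<close> and \<open>v\<close>, which is what
  Schwarz's theorem exploits.
\<close>

lemma second_difference_eq:
  fixes f :: "'a::real_normed_vector \<Rightarrow> real"
  assumes f: "Ck_on (Suc (Suc 0)) S f" and h: "0 < h"
    and S: "\<And>a b. 0 \<le> a \<Longrightarrow> a \<le> h \<Longrightarrow> 0 \<le> b \<Longrightarrow> b \<le> h \<Longrightarrow> x + a *\<^sub>R u + b *\<^sub>R v \<in> S"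
  obtains a b where "0 < a" "a < h" "0 < b" "b < h"
    "f (x + h *\<^sub>R u + h *\<^sub>R v) - f (x + h *\<^sub>R u) - f (x + h *\<^sub>R v) + f x
      = h * (h * dderiv (dderiv f u) v (x + a *\<^sub>R u + b *\<^sub>R v))"
proof -
  have d: "((\<lambda>t. f (x + t *\<^sub>R u + b *\<^sub>R v)) has_real_derivative dderiv f u (x + t *\<^sub>R u + b *\<^sub>R v)) (at t)"
    if "0 \<le> t" "t \<le> h" "0 \<le> b" "b \<le> h" for t b
  proof -
    note F = Ck_on_has_derivative[OF f S[OF that]]
    have "((\<lambda>t. f (x + t *\<^sub>R u + b *\<^sub>R v)) has_derivative
        (\<lambda>r. dderiv f (r *\<^sub>R u) (x + t *\<^sub>R u + b *\<^sub>R v))) (at t)"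
      by (rule has_derivative_compose[of "\<lambda>t. x + t *\<^sub>R u + b *\<^sub>R v", OF _ F])
         (auto intro!: derivative_eq_intros)
    then show ?thesis
      using linear_scale[OF dderiv_linear[OF f S[OF that]]]
      by (simp add: has_field_derivative_def mult.commute[of _ "dderiv f u _"])
  qed
  have d0: "((\<lambda>t. f (x + t *\<^sub>R u)) has_real_derivative dderiv f u (x + t *\<^sub>R u)) (at t)"
    if "0 \<le> t" "t \<le> h" for t
    using d[OF that, of 0] h by simp
  have "\<exists>a. 0 < a \<and> a < h \<and>
     (f (x + h *\<^sub>R u + h *\<^sub>R v) - f (x + h *\<^sub>R u)) - (f (x + 0 *\<^sub>R u + h *\<^sub>R v) - f (x + 0 *\<^sub>R u))
     = (h - 0) * (dderiv f u (x + a *\<^sub>R u + h *\<^sub>R v) - dderiv f u (x + a *\<^sub>R u))"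
    by (rule MVT2[OF h]) (use h in \<open>auto intro!: DERIV_diff d d0\<close>)
  then obtain a where a: "0 < a" "a < h" and
    A: "(f (x + h *\<^sub>R u + h *\<^sub>R v) - f (x + h *\<^sub>R u)) - (f (x + h *\<^sub>R v) - f x)
     = h * (dderiv f u (x + a *\<^sub>R u + h *\<^sub>R v) - dderiv f u (x + a *\<^sub>R u))" by auto
  have f2: "Ck_on (Suc 0) S (dderiv f u)" using f by simp
  have e: "((\<lambda>t. dderiv f u (x + a *\<^sub>R u + t *\<^sub>R v)) has_real_derivative
      dderiv (dderiv f u) v (x + a *\<^sub>R u + t *\<^sub>R v)) (at t)"
    if t: "0 \<le> t" "t \<le> h" for t
  proof -
    have i: "x + a *\<^sub>R u + t *\<^sub>R v \<in> S" using S[of a t] a t by simp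
    note F = Ck_on_has_derivative[OF f2 i]
    have "((\<lambda>t. dderiv f u (x + a *\<^sub>R u + t *\<^sub>R v)) has_derivative
        (\<lambda>r. dderiv (dderiv f u) (r *\<^sub>R v) (x + a *\<^sub>R u + t *\<^sub>R v))) (at t)"
      by (rule has_derivative_compose[of "\<lambda>t. x + a *\<^sub>R u + t *\<^sub>R v", OF _ F])
         (auto intro!: derivative_eq_intros)
    then show ?thesis
      using linear_scale[OF dderiv_linear[OF f2 i]]
      by (simp add: has_field_derivative_def mult.commute[of _ "dderiv (dderiv f u) v _"])
  qed
  have "\<exists>b. 0 < b \<and> b < h \<and>
     dderiv f u (x + a *\<^sub>R u + h *\<^sub>R v) - dderiv f u (x + a *\<^sub>R u + 0 *\<^sub>R v)
     = (h - 0) * (dderiv (dderiv f u) v (x + a *\<^sub>R u + b *\<^sub>R v))"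
    by (rule MVT2[OF h e])
  then obtain b where "0 < b" "b < h"
     "dderiv f u (x + a *\<^sub>R u + h *\<^sub>R v) - dderiv f u (x + a *\<^sub>R u)
     = h * (dderiv (dderiv f u) v (x + a *\<^sub>R u + b *\<^sub>R v))" by auto
  with a A show ?thesis by (intro that[of a b]) auto
qed

text \<open>
  Over small parallelograms at \<open>x\<close> the same second difference is close to both mixed derivatives
  times \<open>h\<^sup>2\<close>, by their continuity.
\<close>

lemma dderiv_commute_real:
  fixes f :: "'a::real_normed_vector \<Rightarrow> real"
  assumes f: "Ck_on (Suc (Suc 0)) S f" and S: "open S" "x \<in> S"
  shows "dderiv (dderiv f u) v x = dderiv (dderiv f v) u x"
proof (rule ccontr)
  let ?A = "dderiv (dderiv f u) v" and ?B = "dderiv (dderiv f v) u"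
  assume ne: "?A x \<noteq> ?B x"
  define e where "e = \<bar>?A x - ?B x\<bar> / 2"
  have e: "e > 0" using ne by (simp add: e_def)
  have "continuous_on S ?A" "continuous_on S ?B" using f by simp_all
  then have "isCont ?A x" "isCont ?B x"
    using S by (auto simp: continuous_on_eq_continuous_at)
  then obtain d1 d2 where d: "d1 > 0" "d2 > 0"
    and A: "\<And>y. dist y x < d1 \<Longrightarrow> dist (?A y) (?A x) < e"
    and B: "\<And>y. dist y x < d2 \<Longrightarrow> dist (?B y) (?B x) < e"
    using e unfolding continuous_at_eps_delta by metis
  obtain d3 where d3: "d3 > 0" "ball x d3 \<subseteq> S"
    using S open_contains_ball by blast
  define d where "d = min d1 (min d2 d3)"
  have d0: "d > 0" using d d3 by (simp add: d_def)
  \<comment> \<open>The summand 1 avoids a division by zero when both directions vanish.\<close>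
  define h where "h = d / (2 * (norm u + norm v + 1))"
  have h: "h > 0" using d0 unfolding h_def by (intro divide_pos_pos mult_pos_pos add_nonneg_pos) auto
  have hd: "h * (norm u + norm v) < d"
  proof -
    have "h * (norm u + norm v) \<le> h * (norm u + norm v + 1)" using h by simp
    also have "\<dots> = d / 2"
    proof -
      have "d / (2 * n) * n = d / 2" if "n > 0" for n using that by simp
      from this[of "norm u + norm v + 1"] show ?thesis
        unfolding h_def using add_nonneg_pos[of "norm u + norm v" 1] by (simp only: norm_ge_zero add_nonneg_nonneg zero_less_one simp_thms)
    qed
    finally show ?thesis using d0 by simp
  qed
  have near: "dist (x + a *\<^sub>R u' + b *\<^sub>R v') x < d"
    if "0 \<le> a" "a \<le> h" "0 \<le> b" "b \<le> h" "norm u' + norm v' = norm u + norm v" for a b u' v'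
  proof -
    have "dist (x + a *\<^sub>R u' + b *\<^sub>R v') x \<le> norm (a *\<^sub>R u') + norm (b *\<^sub>R v')"
      by (simp add: dist_norm norm_triangle_ineq add.assoc del: norm_scaleR)
    also have "\<dots> = a * norm u' + b * norm v'" using that by simp
    also have "\<dots> \<le> h * norm u' + h * norm v'"
      using that by (intro add_mono mult_right_mono) auto
    also have "\<dots> = h * (norm u + norm v)" using that(5) by (simp add: distrib_left[symmetric])
    finally show ?thesis using hd by linarith
  qed
  have inS: "y \<in> S" if "dist y x < d" for y
    using that d3(2) by (auto simp: d_def dist_commute)
  obtain a b where ab: "0 < a" "a < h" "0 < b" "b < h" and
    E1: "f (x + h *\<^sub>R u + h *\<^sub>R v) - f (x + h *\<^sub>R u) - f (x + h *\<^sub>R v) + f x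
      = h * (h * ?A (x + a *\<^sub>R u + b *\<^sub>R v))"
    by (rule second_difference_eq[OF f h, of x u v]) (use inS near in auto)
  obtain a' b' where ab': "0 < a'" "a' < h" "0 < b'" "b' < h" and
    E2: "f (x + h *\<^sub>R v + h *\<^sub>R u) - f (x + h *\<^sub>R v) - f (x + h *\<^sub>R u) + f x
      = h * (h * ?B (x + a' *\<^sub>R v + b' *\<^sub>R u))"
    by (rule second_difference_eq[OF f h, of x v u]) (use inS near in auto)
  have eq: "x + h *\<^sub>R v + h *\<^sub>R u = x + h *\<^sub>R u + h *\<^sub>R v" by simp
  have "h * (h * ?A (x + a *\<^sub>R u + b *\<^sub>R v)) = h * (h * ?B (x + a' *\<^sub>R v + b' *\<^sub>R u))"
    using E1 E2 unfolding eq by linarith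
  then have E: "?A (x + a *\<^sub>R u + b *\<^sub>R v) = ?B (x + a' *\<^sub>R v + b' *\<^sub>R u)" using h by simp
  have "dist (?A (x + a *\<^sub>R u + b *\<^sub>R v)) (?A x) < e"
    by (rule A) (use near[of a b u v] ab in \<open>simp add: d_def\<close>)
  moreover have "dist (?B (x + a' *\<^sub>R v + b' *\<^sub>R u)) (?B x) < e"
    by (rule B) (use near[of a' b' v u] ab' in \<open>simp add: d_def\<close>)
  ultimately show False unfolding E dist_real_def e_def by (simp add: abs_if split: if_splits)
qed

lemma dderiv_bounded_linear:
  assumes "bounded_linear L" "Ck_on (Suc k) S f" "x \<in> S"
  shows "dderiv (\<lambda>x. L (f x)) v x = L (dderiv f v x)"
  using frechet_derivative_at[OF bounded_linear.has_derivative[OF assms(1) Ck_on_has_derivative[OF assms(2,3)]]]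
  by metis

text \<open>
  Derivatives at points of an open set depend only on the values there.
\<close>

lemma Ck_on_cong:
  assumes "open S" "\<And>x. x \<in> S \<Longrightarrow> f x = g x" "Ck_on k S f"
  shows "Ck_on k S g"
  using assms(2,3)
proof (induction k arbitrary: f g)
  case 0
  then show ?case using continuous_on_cong[of S S f g] by auto
next
  case (Suc k)
  have D: "(g has_derivative (\<lambda>v. dderiv f v x)) (at x)" if "x \<in> S" for x
    by (rule has_derivative_transform_within_open[OF Ck_on_has_derivative[OF Suc.prems(2) that] assms(1) that])
       (use Suc.prems in auto)
  then have "dderiv f v x = dderiv g v x" if "x \<in> S" for x v
    using frechet_derivative_at[OF D[OF that]] by metis
  then have "Ck_on k S (dderiv g v)" for v
    using Suc.IH[of "dderiv f v" "dderiv g v"] Suc.prems by auto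
  moreover have "g differentiable (at x)" if "x \<in> S" for x
    using D[OF that] by (auto simp: differentiable_def)
  ultimately show ?case by simp
qed

lemma Ck_on_bounded_linear:
  assumes "bounded_linear L" "open S" "Ck_on k S f"
  shows "Ck_on k S (\<lambda>x. L (f x))"
  using assms(3)
proof (induction k arbitrary: f)
  case 0
  then show ?case using bounded_linear.continuous_on[OF assms(1)] by auto
next
  case (Suc k)
  have "Ck_on k S (dderiv (\<lambda>x. L (f x)) v)" for v
  proof (rule Ck_on_cong[OF assms(2)])
    show "Ck_on k S (\<lambda>x. L (dderiv f v x))" using Suc by simp
  qed (simp add: dderiv_bounded_linear[OF assms(1) Suc.prems])
  moreover have "(\<lambda>x. L (f x)) differentiable (at x)" if "x \<in> S" for x
    using bounded_linear.has_derivative[OF assms(1) Ck_on_has_derivative[OF Suc.prems that]]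
    by (auto simp: differentiable_def)
  ultimately show ?case by simp
qed

text \<open>
  The real case applies to all components \<open>f x \<bullet> z\<close>.
\<close>

lemma dderiv_commute:
  fixes f :: "'a::real_normed_vector \<Rightarrow> 'b::real_inner"
  assumes f: "Ck_on (Suc (Suc 0)) S f" and S: "open S" "x \<in> S"
  shows "dderiv (dderiv f u) v x = dderiv (dderiv f v) u x"
proof -
  have "dderiv (dderiv f u) v x \<bullet> z = dderiv (dderiv f v) u x \<bullet> z" for z
  proof -
    note L = bounded_linear_inner_left[of z]
    have tw: "dderiv (dderiv (\<lambda>x. f x \<bullet> z) p) q x = dderiv (dderiv f p) q x \<bullet> z" for p q
    proof -
      have "((\<lambda>x. f x \<bullet> z) has_derivative (\<lambda>v. dderiv f v y \<bullet> z)) (at y)" if "y \<in> S" for y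
        by (rule bounded_linear.has_derivative[OF L Ck_on_has_derivative[OF f that]])
      have c: "Ck_on (Suc 0) S (dderiv f p)" using f by simp
      have "((\<lambda>x. dderiv f p x \<bullet> z) has_derivative (\<lambda>v. dderiv (dderiv f p) v x \<bullet> z)) (at x)"
        by (rule bounded_linear.has_derivative[OF L Ck_on_has_derivative[OF c S(2)]])
      then have "(dderiv (\<lambda>x. f x \<bullet> z) p has_derivative (\<lambda>v. dderiv (dderiv f p) v x \<bullet> z)) (at x)"
        by (rule has_derivative_transform_within_open[OF _ S])
           (simp add: dderiv_bounded_linear[OF L f])
      from frechet_derivative_at[OF this] show ?thesis by metis
    qed
    show ?thesis
      using dderiv_commute_real[OF Ck_on_bounded_linear[OF L S(1) f] S, of u v] unfolding tw .
  qed
  then show ?thesis by (metis vector_eq_ldot inner_commute)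
qed

section \<open>Locally Lipschitz maps\<close>

definition locally_lipschitz_at :: "('a::metric_space \<Rightarrow> 'b::metric_space) \<Rightarrow> 'a \<Rightarrow> bool"
  where "locally_lipschitz_at f x \<longleftrightarrow> (\<exists>r>0. \<exists>L. L-lipschitz_on (cball x r) f)"

lemma locally_lipschitz_atI:
  assumes "r > 0"
    and lip: "\<And>x y. x \<in> cball a r \<Longrightarrow> y \<in> cball a r \<Longrightarrow> dist (f x) (f y) \<le> L * dist x y"
  shows "locally_lipschitz_at f a"
proof -
  have "(max L 0)-lipschitz_on (cball a r) f"
  proof (rule lipschitz_onI)
    fix x y assume "x \<in> cball a r" "y \<in> cball a r"
    from lip[OF this] show "dist (f x) (f y) \<le> max L 0 * dist x y"
      by (rule order_trans) (simp add: mult_right_mono)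
  qed simp
  then show ?thesis unfolding locally_lipschitz_at_def using assms(1) by blast
qed

lemma locally_lipschitz_at_E:
  assumes "locally_lipschitz_at f a"
  obtains r L where "r > 0" "L \<ge> 0" "\<And>s. s \<le> r \<Longrightarrow> L-lipschitz_on (cball a s) f"
  using assms unfolding locally_lipschitz_at_def
  by (metis lipschitz_on_nonneg lipschitz_on_subset subset_cball)

lemma locally_lipschitz_at_continuous:
  assumes "locally_lipschitz_at f a" shows "isCont f a"
proof -
  obtain r L where r: "r > 0" "\<And>s. s \<le> r \<Longrightarrow> L-lipschitz_on (cball a s) f"
    using locally_lipschitz_at_E[OF assms] by metis
  have "continuous_on (ball a r) f"
    using lipschitz_on_continuous_on[OF r(2)[of r]] continuous_on_subset ball_subset_cball by blast
  then show ?thesis using r(1) by (simp add: continuous_on_eq_continuous_at)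
qed

lemma locally_lipschitz_at_const: "locally_lipschitz_at (\<lambda>x. c) a"
  by (rule locally_lipschitz_atI[of 1 _ _ 0]) auto

lemma locally_lipschitz_at_add:
  fixes f g :: "'a::metric_space \<Rightarrow> 'b::real_normed_vector"
  assumes "locally_lipschitz_at f a" "locally_lipschitz_at g a"
  shows "locally_lipschitz_at (\<lambda>x. f x + g x) a"
proof -
  obtain r L where r: "r > 0" "\<And>s. s \<le> r \<Longrightarrow> L-lipschitz_on (cball a s) f"
    using locally_lipschitz_at_E[OF assms(1)] by metis
  obtain r' L' where r': "r' > 0" "\<And>s. s \<le> r' \<Longrightarrow> L'-lipschitz_on (cball a s) g"
    using locally_lipschitz_at_E[OF assms(2)] by metis
  have "(L + L')-lipschitz_on (cball a (min r r')) (\<lambda>x. f x + g x)"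
    by (intro lipschitz_on_add r r') auto
  then show ?thesis unfolding locally_lipschitz_at_def using r(1) r'(1)
    by (intro exI[of _ "min r r'"] conjI exI[of _ "L + L'"]) auto
qed

lemma locally_lipschitz_at_sum:
  fixes f :: "'i \<Rightarrow> 'a::metric_space \<Rightarrow> 'b::real_normed_vector"
  assumes "\<And>i. i \<in> A \<Longrightarrow> locally_lipschitz_at (f i) a"
  shows "locally_lipschitz_at (\<lambda>x. \<Sum>i\<in>A. f i x) a"
  using assms
  by (induction A rule: infinite_finite_induct)
     (auto simp: locally_lipschitz_at_const locally_lipschitz_at_add)

lemma locally_lipschitz_at_scaleR:
  fixes f :: "'a::metric_space \<Rightarrow> real" and g :: "'a \<Rightarrow> 'b::real_normed_vector"
  assumes "locally_lipschitz_at f a" "locally_lipschitz_at g a"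
  shows "locally_lipschitz_at (\<lambda>x. f x *\<^sub>R g x) a"
proof -
  obtain r L where r: "r > 0" "L \<ge> 0" "\<And>s. s \<le> r \<Longrightarrow> L-lipschitz_on (cball a s) f"
    using locally_lipschitz_at_E[OF assms(1)] by metis
  obtain r' L' where r': "r' > 0" "L' \<ge> 0" "\<And>s. s \<le> r' \<Longrightarrow> L'-lipschitz_on (cball a s) g"
    using locally_lipschitz_at_E[OF assms(2)] by metis
  define R where "R = min r r'"
  have R: "R > 0" using r r' by (simp add: R_def)
  have Lf: "L-lipschitz_on (cball a R) f" and Lg: "L'-lipschitz_on (cball a R) g"
    using r r' by (auto simp: R_def)
  have bf: "\<bar>f x\<bar> \<le> \<bar>f a\<bar> + L * R" if "x \<in> cball a R" for x
  proof -
    have "dist (f x) (f a) \<le> L * dist x a" using lipschitz_onD[OF Lf that] R by simp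
    also have "\<dots> \<le> L * R" using that r(2) by (intro mult_left_mono) (auto simp: dist_commute)
    finally show ?thesis by (simp add: dist_real_def)
  qed
  have bg: "norm (g x) \<le> norm (g a) + L' * R" if "x \<in> cball a R" for x
  proof -
    have "dist (g x) (g a) \<le> L' * dist x a" using lipschitz_onD[OF Lg that] R by simp
    also have "\<dots> \<le> L' * R" using that r'(2) by (intro mult_left_mono) (auto simp: dist_commute)
    finally show ?thesis using norm_triangle_ineq2[of "g x" "g a"] by (simp add: dist_norm)
  qed
  show ?thesis
  proof (rule locally_lipschitz_atI[OF R])
    fix x y assume x: "x \<in> cball a R" and y: "y \<in> cball a R"
    have "f x *\<^sub>R g x - f y *\<^sub>R g y = f x *\<^sub>R (g x - g y) + (f x - f y) *\<^sub>R g y"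
      by (simp add: algebra_simps)
    then have "dist (f x *\<^sub>R g x) (f y *\<^sub>R g y) \<le> \<bar>f x\<bar> * dist (g x) (g y) + dist (f x) (f y) * norm (g y)"
      by (metis dist_norm norm_scaleR norm_triangle_ineq real_norm_def)
    also have "\<dots> \<le> (\<bar>f a\<bar> + L * R) * (L' * dist x y) + (L * dist x y) * (norm (g a) + L' * R)"
      using r r' R by (intro add_mono mult_mono bf bg lipschitz_onD[OF Lf] lipschitz_onD[OF Lg] x y) auto
    also have "\<dots> = ((\<bar>f a\<bar> + L * R) * L' + L * (norm (g a) + L' * R)) * dist x y"
      by (simp add: algebra_simps)
    finally show "dist (f x *\<^sub>R g x) (f y *\<^sub>R g y)
      \<le> ((\<bar>f a\<bar> + L * R) * L' + L * (norm (g a) + L' * R)) * dist x y" .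
  qed
qed

lemma locally_lipschitz_at_bounded_linear:
  assumes "bounded_linear f" shows "locally_lipschitz_at f a"
proof -
  obtain B where "B-lipschitz_on UNIV f" using bounded_linear.lipschitz_boundE[OF assms] by metis
  then show ?thesis
    unfolding locally_lipschitz_at_def by (metis lipschitz_on_subset subset_UNIV zero_less_one)
qed

lemma locally_lipschitz_at_compose:
  assumes "locally_lipschitz_at g a" "locally_lipschitz_at f (g a)"
  shows "locally_lipschitz_at (\<lambda>x. f (g x)) a"
proof -
  obtain r L where r: "r > 0" "L \<ge> 0" "\<And>s. s \<le> r \<Longrightarrow> L-lipschitz_on (cball a s) g"
    using locally_lipschitz_at_E[OF assms(1)] by metis
  obtain r' L' where r': "r' > 0" "\<And>s. s \<le> r' \<Longrightarrow> L'-lipschitz_on (cball (g a) s) f"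
    using locally_lipschitz_at_E[OF assms(2)] by metis
  define R where "R = min r (r' / (L + 1))"
  have R: "R > 0" "R \<le> r" using r r' by (auto simp: R_def)
  have Lg: "L-lipschitz_on (cball a R) g" by (rule r(3)[OF R(2)])
  have "g ` cball a R \<subseteq> cball (g a) r'"
  proof safe
    fix x assume x: "x \<in> cball a R"
    have "dist (g a) (g x) \<le> L * dist a x" using lipschitz_onD[OF Lg _ x] R by simp
    also have "\<dots> \<le> L * R" using x r(2) by (intro mult_left_mono) auto
    also have "\<dots> \<le> (L + 1) * R" using R by (intro mult_right_mono) auto
    also have "\<dots> \<le> (L + 1) * (r' / (L + 1))" using r(2) by (intro mult_left_mono) (auto simp: R_def)
    also have "\<dots> = r'" using r(2) by simp
    finally show "g x \<in> cball (g a) r'" by simp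
  qed
  then have "L'-lipschitz_on (g ` cball a R) f" using r'(2)[of r'] lipschitz_on_subset by blast
  from lipschitz_on_compose2[OF Lg this] show ?thesis
    unfolding locally_lipschitz_at_def using R by auto
qed

lemma locally_lipschitz_at_Pair:
  fixes f :: "'a::metric_space \<Rightarrow> 'b::real_normed_vector" and g :: "'a \<Rightarrow> 'c::real_normed_vector"
  assumes "locally_lipschitz_at f a" "locally_lipschitz_at g a"
  shows "locally_lipschitz_at (\<lambda>x. (f x, g x)) a"
proof -
  obtain r L where r: "r > 0" "L \<ge> 0" "\<And>s. s \<le> r \<Longrightarrow> L-lipschitz_on (cball a s) f"
    using locally_lipschitz_at_E[OF assms(1)] by metis
  obtain r' L' where r': "r' > 0" "L' \<ge> 0" "\<And>s. s \<le> r' \<Longrightarrow> L'-lipschitz_on (cball a s) g"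
    using locally_lipschitz_at_E[OF assms(2)] by metis
  have "(sqrt (L\<^sup>2 + L'\<^sup>2))-lipschitz_on (cball a (min r r')) (\<lambda>x. (f x, g x))"
    by (intro lipschitz_on_Pair r r') auto
  then show ?thesis unfolding locally_lipschitz_at_def
    using r(1) r'(1) by (metis min_less_iff_conj)
qed

text \<open>
  A finite family admits one radius and one constant, which allows estimates over all
  components of a tensor at once.
\<close>

lemma locally_lipschitz_at_finite:
  assumes "finite A" "\<And>i. i \<in> A \<Longrightarrow> locally_lipschitz_at (f i) a"
  obtains r L where "r > 0" "L \<ge> 0" "\<And>i s. i \<in> A \<Longrightarrow> s \<le> r \<Longrightarrow> L-lipschitz_on (cball a s) (f i)"
proof -
  have "\<exists>r>0. \<exists>L\<ge>0. \<forall>i\<in>A. L-lipschitz_on (cball a r) (f i)"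
    using assms
  proof (induction A rule: finite_induct)
    case empty
    show ?case by (intro exI[of _ 1] conjI exI[of _ 0]) auto
  next
    case (insert j A)
    obtain r L where r: "r > 0" "L \<ge> 0" "\<And>i. i \<in> A \<Longrightarrow> L-lipschitz_on (cball a r) (f i)"
      using insert.IH insert.prems by auto
    obtain r' L' where r': "r' > 0" "L' \<ge> 0" "\<And>s. s \<le> r' \<Longrightarrow> L'-lipschitz_on (cball a s) (f j)"
      using locally_lipschitz_at_E[OF insert.prems[of j]] by blast
    have "(max L L')-lipschitz_on (cball a (min r r')) (f i)" if "i \<in> insert j A" for i
    proof (cases "i = j")
      case True
      then show ?thesis using lipschitz_on_mono[OF r'(3)[of "min r r'"], of "cball a (min r r')" "max L L'"]
        by (simp add: subset_cball)
    next
      case False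
      then show ?thesis using that lipschitz_on_mono[OF r(3)[of i], of "cball a (min r r')" "max L L'"]
        by (simp add: subset_cball)
    qed
    then show ?case using r r' by (metis max.coboundedI1 min_less_iff_conj)
  qed
  then show ?thesis using that lipschitz_on_subset subset_cball by metis
qed

lemma Ck_on_locally_lipschitz:
  fixes f :: "'a::euclidean_space \<Rightarrow> 'b::real_normed_vector"
  assumes f: "Ck_on (Suc 0) S f" and S: "open S" "x \<in> S"
  shows "locally_lipschitz_at f x"
proof -
  obtain r where r: "r > 0" "cball x r \<subseteq> S" using S open_contains_cball by blast
  have "\<exists>B. \<forall>y\<in>cball x r. norm (dderiv f b y) \<le> B" for b
  proof -
    have "continuous_on (cball x r) (dderiv f b)"
      using f r(2) by (auto intro: continuous_on_subset)
    then have "compact (dderiv f b ` cball x r)" by (intro compact_continuous_image) auto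
    then show ?thesis by (meson bounded_iff compact_imp_bounded imageI)
  qed
  then obtain B where B: "\<And>b y. y \<in> cball x r \<Longrightarrow> norm (dderiv f b y) \<le> B b" by metis
  have on: "onorm (\<lambda>v. dderiv f v y) \<le> (\<Sum>b\<in>Basis. B b)" if y: "y \<in> cball x r" for y
  proof (rule onorm_le)
    fix v
    have lin: "linear (\<lambda>v. dderiv f v y)" using dderiv_linear[OF f] y r(2) by blast
    have "dderiv f v y = dderiv f (\<Sum>b\<in>Basis. (v \<bullet> b) *\<^sub>R b) y" by (simp add: euclidean_representation)
    also have "\<dots> = (\<Sum>b\<in>Basis. (v \<bullet> b) *\<^sub>R dderiv f b y)"
      by (simp add: linear_sum[OF lin] linear_scale[OF lin])
    also have "norm \<dots> \<le> (\<Sum>b\<in>Basis. norm v * B b)"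
      by (rule order_trans[OF norm_sum sum_mono])
         (auto intro!: mult_mono Basis_le_norm B y)
    finally show "norm (dderiv f v y) \<le> (\<Sum>b\<in>Basis. B b) * norm v"
      by (simp add: sum_distrib_left mult.commute)
  qed
  show ?thesis
  proof (rule locally_lipschitz_atI[OF r(1)])
    fix y z assume "y \<in> cball x r" "z \<in> cball x r"
    then have "norm (f y - f z) \<le> (\<Sum>b\<in>Basis. B b) * norm (y - z)"
      using r(2)
      by (intro differentiable_bound[where f' = "\<lambda>y v. dderiv f v y", OF convex_cball[of x r] _ on])
         (auto intro!: has_derivative_at_withinI Ck_on_has_derivative[OF f])
    then show "dist (f y) (f z) \<le> (\<Sum>b\<in>Basis. B b) * dist y z" by (simp add: dist_norm)
  qed
qed

section \<open>Existence and uniqueness for ordinary differential equations\<close>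

text \<open>
  The integral equation is solved by Banach's fixed point theorem among bounded continuous functions
  on the whole real line. To define the integral operator there, \<open>F\<close> is composed with the nearest-point
  projection onto a ball, which makes it bounded and globally Lipschitz, and time is clamped to \<open>{0..h}\<close>. For
  small \<open>h\<close> the solution does not leave the ball, so that the projection has no effect on it. A solution on one
  side of \<open>0\<close> suffices to prescribe a position and a velocity.
\<close>

lemma picard_lindelof:
  fixes F :: "'a::euclidean_space \<Rightarrow> 'a"
  assumes "locally_lipschitz_at F x0" "e > 0"
  obtains h x where "h > 0" "x 0 = x0"
    "\<And>t. t \<in> {0..h} \<Longrightarrow> x t \<in> cball x0 e"
    "\<And>t. t \<in> {0..h} \<Longrightarrow> (x has_vector_derivative F (x t)) (at t within {0..h})"
proof -
  obtain r' L where r': "r' > 0" "L \<ge> 0" "\<And>s. s \<le> r' \<Longrightarrow> L-lipschitz_on (cball x0 s) F"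
    using locally_lipschitz_at_E[OF assms(1)] by metis
  define r where "r = min r' e"
  have r: "r > 0" "r \<le> e" and LF: "L-lipschitz_on (cball x0 r) F"
    using r' assms(2) by (auto simp: r_def)
  define pr where "pr = closest_point (cball x0 r)"
  have pr_in: "pr y \<in> cball x0 r" for y
    unfolding pr_def using r by (intro closest_point_in_set) auto
  have pr_lip: "dist (pr y) (pr z) \<le> dist y z" for y z
    unfolding pr_def using r by (intro closest_point_lipschitz) auto
  have pr_id: "pr y = y" if "y \<in> cball x0 r" for y
    unfolding pr_def using that by (rule closest_point_self)
  define G where "G y = F (pr y)" for y
  have G_lip: "dist (G y) (G z) \<le> L * dist y z" for y z
    unfolding G_def using lipschitz_onD[OF LF pr_in pr_in] pr_lip r'(2)
    by (meson mult_left_mono order_trans)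
  have G_cont: "continuous_on A G" for A
    by (rule lipschitz_on_continuous_on[of L], rule lipschitz_onI) (auto simp: G_lip r')
  define B where "B = norm (F x0) + L * r"
  have B: "norm (G y) \<le> B" for y
  proof -
    have "dist (F (pr y)) (F x0) \<le> L * dist (pr y) x0" using lipschitz_onD[OF LF pr_in] r by simp
    also have "\<dots> \<le> L * r" using pr_in r' by (intro mult_left_mono) (auto simp: dist_commute)
    finally show ?thesis using norm_triangle_ineq2[of "F (pr y)" "F x0"]
      by (simp add: G_def B_def dist_norm)
  qed
  have B0: "B \<ge> 0" using order_trans[OF norm_ge_zero B] .
  \<comment> \<open>The first bound keeps the solution in the ball, the second makes the operator a contraction.\<close>
  define h where "h = min (r / (B + 1)) (1 / (2 * (L + 1)))"
  have h: "h > 0" using r B0 r' by (auto simp: h_def)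
  have hB: "h * B \<le> r"
  proof -
    have "h * B \<le> h * (B + 1)" using h by simp
    also have "\<dots> \<le> r / (B + 1) * (B + 1)" using B0 by (intro mult_right_mono) (auto simp: h_def)
    finally show ?thesis using B0 by simp
  qed
  have hL: "h * L \<le> 1 / 2"
  proof -
    have "h * L \<le> h * (L + 1)" using h by simp
    also have "\<dots> \<le> 1 / (2 * (L + 1)) * (L + 1)" using r' by (intro mult_right_mono) (auto simp: h_def)
    also have "\<dots> = 1 / 2" using r' by (simp add: field_simps)
    finally show ?thesis .
  qed
  define cl where "cl t = max 0 (min h t)" for t :: real
  have cl: "cl t \<in> {0..h}" for t using h by (auto simp: cl_def)
  have clid: "cl t = t" if "t \<in> {0..h}" for t using that by (auto simp: cl_def)
  define Q where "Q f t = x0 + integral {0..t} (\<lambda>s. G (f s))" for f :: "real \<Rightarrow> 'a" and t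
  have Gf: "continuous_on A (\<lambda>s. G (apply_bcontfun f s))"
    for A and f :: "real \<Rightarrow>\<^sub>C 'a"
    by (rule continuous_on_compose2[OF G_cont[of UNIV]]) auto
  have Gint: "(\<lambda>s. G (apply_bcontfun f s)) integrable_on {0..t}"
    for f :: "real \<Rightarrow>\<^sub>C 'a" and t
    by (intro integrable_continuous_real Gf)
  have Qd: "(Q (apply_bcontfun f) has_vector_derivative G (f t)) (at t within {0..h})"
    if "t \<in> {0..h}" for f t
    unfolding Q_def using integral_has_vector_derivative[OF Gf that]
    by (auto intro!: derivative_eq_intros)
  have Qc: "continuous_on {0..h} (Q (apply_bcontfun f))"
    for f :: "real \<Rightarrow>\<^sub>C 'a"
    by (auto simp: continuous_on_eq_continuous_within intro!: has_vector_derivative_continuous Qd)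
  have Qb: "dist x0 (Q (apply_bcontfun f) t) \<le> r" if "t \<in> {0..h}" for f t
  proof -
    have "norm (integral {0..t} (\<lambda>s. G (apply_bcontfun f s))) \<le> B * (t - 0)"
      using that by (intro integral_bound Gf B) auto
    also have "\<dots> \<le> B * h" using that B0 by (intro mult_left_mono) auto
    finally show ?thesis using hB by (simp add: Q_def dist_norm mult.commute)
  qed
  have Pb: "(\<lambda>t. Q (apply_bcontfun f) (cl t)) \<in> bcontfun" for f
  proof (rule bcontfun_normI[of _ "norm x0 + r"])
    show "continuous_on UNIV (\<lambda>t. Q (apply_bcontfun f) (cl t))"
      by (rule continuous_on_compose2[OF Qc])
         (use cl in \<open>auto simp: cl_def[abs_def] intro!: continuous_intros\<close>)
    show "norm (Q (apply_bcontfun f) (cl t)) \<le> norm x0 + r" for t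
      using Qb[OF cl, of f t] norm_triangle_ineq3[of x0 "Q (apply_bcontfun f) (cl t)"]
      by (simp add: dist_norm)
  qed
  define P where "P f = Bcontfun (\<lambda>t. Q (apply_bcontfun f) (cl t))" for f :: "real \<Rightarrow>\<^sub>C 'a"
  have P: "apply_bcontfun (P f) t = Q (apply_bcontfun f) (cl t)" for f t
    unfolding P_def using Bcontfun_inverse[OF Pb] by simp
  have "dist (P f) (P g) \<le> 1 / 2 * dist f g" for f g
  proof (rule dist_bound)
    fix t
    let ?D = "\<lambda>s. G (apply_bcontfun f s) - G (apply_bcontfun g s)"
    have "dist (P f t) (P g t) = norm (integral {0..cl t} ?D)"
      unfolding P Q_def by (simp add: dist_norm integral_diff[OF Gint Gint])
    also have "\<dots> \<le> L * dist f g * (cl t - 0)"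
    proof (rule integral_bound)
      show "norm (?D s) \<le> L * dist f g" for s
        using order_trans[OF G_lip mult_left_mono[OF dist_bounded r'(2)]] by (simp add: dist_norm)
    qed (use cl[of t] in \<open>auto intro!: continuous_intros Gf\<close>)
    also have "\<dots> \<le> L * dist f g * h" using cl[of t] r'(2) by (intro mult_left_mono) auto
    also have "\<dots> = (h * L) * dist f g" by simp
    also have "\<dots> \<le> 1 / 2 * dist f g" by (rule mult_right_mono[OF hL]) simp
    finally show "dist (P f t) (P g t) \<le> 1 / 2 * dist f g" .
  qed
  then have "\<exists>!f. P f = f" by (intro banach_fix_type[of "1/2"]) auto
  then obtain f where f: "P f = f" by blast
  have fx: "f t = Q (apply_bcontfun f) t" if "t \<in> {0..h}" for t
    using P[of f t] clid[OF that] f by simp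
  have fin: "f t \<in> cball x0 r" if "t \<in> {0..h}" for t
    using Qb[OF that, of f] fx[OF that] by simp
  show ?thesis
  proof (rule that[OF h, of "apply_bcontfun f"])
    show "f 0 = x0" using fx[of 0] h by (simp add: Q_def)
    show "f t \<in> cball x0 e" if "t \<in> {0..h}" for t using fin[OF that] r by auto
    show "(apply_bcontfun f has_vector_derivative F (f t)) (at t within {0..h})" if t: "t \<in> {0..h}" for t
    proof -
      have "(apply_bcontfun f has_vector_derivative G (f t)) (at t within {0..h})"
        by (rule has_vector_derivative_transform[OF t fx Qd[OF t]])
      then show ?thesis using pr_id[OF fin[OF t]] by (simp add: G_def)
    qed
  qed
qed

text \<open>
  Gronwall's argument: \<open>h exp (-C t)\<close> decreases to the right of \<open>s0\<close> and \<open>h exp (C t)\<close> increases to its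
  left.
\<close>

lemma gronwall_zero:
  fixes h h' :: "real \<Rightarrow> real"
  assumes K: "is_interval K" and s: "s0 \<in> K" "s \<in> K" and h0: "h s0 = 0" and nonneg: "h s \<ge> 0"
    and d: "\<And>t. t \<in> K \<Longrightarrow> (h has_real_derivative h' t) (at t within K)"
    and b: "\<And>t. t \<in> K \<Longrightarrow> \<bar>h' t\<bar> \<le> C * h t"
  shows "h s = 0"
proof -
  have sub: "{min s0 s..max s0 s} \<subseteq> K"
    using mem_is_interval_1_I[OF K, of "min s0 s" "max s0 s"] s
    by (auto simp: min_def max_def split: if_splits)
  have E: "((\<lambda>t. h t * exp (c * t)) has_real_derivative (h' t + c * h t) * exp (c * t))
      (at t within {min s0 s..max s0 s})" if "t \<in> {min s0 s..max s0 s}" for t c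
  proof -
    have hd: "(h has_real_derivative h' t) (at t within {min s0 s..max s0 s})"
      by (rule DERIV_subset[OF d sub]) (use that sub in blast)
    show ?thesis by (rule derivative_eq_intros hd refl | simp)+ (simp add: algebra_simps)
  qed
  have cont: "continuous_on {min s0 s..max s0 s} (\<lambda>t. h t * exp (c * t))" for c
    unfolding continuous_on_eq_continuous_within by (intro ballI DERIV_continuous[OF E])
  have E': "((\<lambda>t. h t * exp (c * t)) has_real_derivative (h' t + c * h t) * exp (c * t)) (at t)"
    if "min s0 s < t" "t < max s0 s" for t c
    using E[of t c] that unfolding at_within_Icc_at[OF that] by simp
  have b': "h' t + - C * h t \<le> 0" "h' t + C * h t \<ge> 0" if "min s0 s < t" "t < max s0 s" for t
  proof -
    have "t \<in> K" using that sub by (auto simp: subset_eq)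
    from b[OF this] show "h' t + - C * h t \<le> 0" "h' t + C * h t \<ge> 0" by linarith+
  qed
  show ?thesis
  proof (cases "s0 \<le> s")
    case True
    have "h s * exp (- C * s) \<le> h s0 * exp (- C * s0)"
    proof (rule DERIV_nonpos_imp_decreasing_open[OF True])
      show "continuous_on {s0..s} (\<lambda>t. h t * exp (- C * t))" using cont[of "- C"] True by simp
      show "\<exists>y. ((\<lambda>t. h t * exp (- C * t)) has_real_derivative y) (at t) \<and> y \<le> 0"
        if "s0 < t" "t < s" for t
      proof -
        have m: "min s0 s < t" "t < max s0 s" using that by auto
        have "(h' t + - C * h t) * exp (- C * t) \<le> 0"
          by (rule mult_nonpos_nonneg[OF b'(1)[OF m]]) simp
        with E'[OF m] show ?thesis by blast
      qed
    qed
    then show ?thesis using h0 nonneg by (simp add: mult_le_0_iff)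
  next
    case False
    then have le: "s \<le> s0" by simp
    have "h s * exp (C * s) \<le> h s0 * exp (C * s0)"
    proof (rule DERIV_nonneg_imp_increasing_open[OF le])
      show "continuous_on {s..s0} (\<lambda>t. h t * exp (C * t))" using cont[of C] le by simp
      show "\<exists>y. ((\<lambda>t. h t * exp (C * t)) has_real_derivative y) (at t) \<and> y \<ge> 0"
        if "s < t" "t < s0" for t
      proof -
        have m: "min s0 s < t" "t < max s0 s" using that by auto
        have "(h' t + C * h t) * exp (C * t) \<ge> 0"
          by (rule mult_nonneg_nonneg[OF b'(2)[OF m]]) simp
        with E'[OF m] show ?thesis by blast
      qed
    qed
    then show ?thesis using h0 nonneg by (simp add: mult_le_0_iff)
  qed
qed

section \<open>Expansion in a basis\<close>

lemma linear_expand: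
  fixes f :: "'a::euclidean_space \<Rightarrow> 'b::real_vector"
  assumes "linear f" shows "f u = (\<Sum>b\<in>Basis. (u \<bullet> b) *\<^sub>R f b)"
proof -
  have "f u = f (\<Sum>b\<in>Basis. (u \<bullet> b) *\<^sub>R b)" by (simp add: euclidean_representation)
  also have "\<dots> = (\<Sum>b\<in>Basis. (u \<bullet> b) *\<^sub>R f b)"
    by (simp add: linear_sum[OF assms] linear_scale[OF assms])
  finally show ?thesis .
qed

lemma bilinear_expand:
  fixes f :: "'a::euclidean_space \<Rightarrow> 'c::euclidean_space \<Rightarrow> 'b::real_vector"
  assumes "bilinear f"
  shows "f u v = (\<Sum>b\<in>Basis. \<Sum>b'\<in>Basis. ((u \<bullet> b) * (v \<bullet> b')) *\<^sub>R f b b')"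
proof -
  have l1: "linear (\<lambda>x. f x y)" and l2: "linear (f x)" for x y
    using assms by (auto simp: bilinear_def)
  have "f u v = (\<Sum>b\<in>Basis. (u \<bullet> b) *\<^sub>R f b v)"
    by (rule linear_expand[OF l1])
  also have "\<dots> = (\<Sum>b\<in>Basis. (u \<bullet> b) *\<^sub>R (\<Sum>b'\<in>Basis. (v \<bullet> b') *\<^sub>R f b b'))"
    by (subst linear_expand[OF l2, of _ v]) (rule refl)
  finally show ?thesis by (simp add: scaleR_sum_right)
qed

lemma sum_Basis_bound:
  fixes u :: "'a::euclidean_space"
  assumes "\<And>b. b \<in> Basis \<Longrightarrow> \<bar>q b\<bar> \<le> C"
  shows "\<bar>\<Sum>b\<in>Basis. (u \<bullet> b) * q b\<bar> \<le> real DIM('a) * C * norm u"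
proof -
  have "\<bar>\<Sum>b\<in>Basis. (u \<bullet> b) * q b\<bar> \<le> (\<Sum>b\<in>(Basis::'a set). norm u * C)"
    by (rule order_trans[OF sum_abs sum_mono])
       (auto simp: abs_mult intro!: mult_mono Basis_le_norm assms)
  then show ?thesis by (simp add: ac_simps)
qed

section \<open>The Levi-Civita connection in coordinates\<close>

text \<open>
  The right-hand side of the Koszul formula for fields with constant components.
\<close>

definition koszul :: "('e::real_normed_vector \<Rightarrow> 'e \<Rightarrow> 'e \<Rightarrow> real) \<Rightarrow> 'e \<Rightarrow> 'e \<Rightarrow> 'e \<Rightarrow> 'e \<Rightarrow> real"
  where "koszul g x u v z =
    dderiv (\<lambda>y. g y v z) u x + dderiv (\<lambda>y. g y u z) v x - dderiv (\<lambda>y. g y u v) z x"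

definition levi_civita :: "('e::real_normed_vector \<Rightarrow> 'e \<Rightarrow> 'e \<Rightarrow> real) \<Rightarrow> 'e \<Rightarrow> 'e \<Rightarrow> 'e \<Rightarrow> 'e"
  where "levi_civita g x u v = (THE w. \<forall>z. 2 * g x w z = koszul g x u v z)"

lemma christoffel_eq: "christoffel X c = levi_civita (local_metric X c)"
  by (intro ext) (simp add: christoffel_def levi_civita_def koszul_def)

text \<open>
  The local expression of a Riemannian metric in one chart, with \<open>U\<close> the range of the chart.
\<close>

locale smooth_metric =
  fixes U :: "'e::euclidean_space set" and g :: "'e \<Rightarrow> 'e \<Rightarrow> 'e \<Rightarrow> real"
  assumes open_U: "open U"
    and smooth: "smooth_map_on U (\<lambda>x. g x u v)"
    and bilin: "x \<in> U \<Longrightarrow> bilinear (g x)"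
    and symm: "x \<in> U \<Longrightarrow> g x u v = g x v u"
    and pos: "x \<in> U \<Longrightarrow> u \<noteq> 0 \<Longrightarrow> 0 < g x u u"
begin

abbreviation dg :: "'e \<Rightarrow> 'e \<Rightarrow> 'e \<Rightarrow> 'e \<Rightarrow> real"
  where "dg x u v z \<equiv> dderiv (\<lambda>y. g y u v) z x"

abbreviation \<Gamma> :: "'e \<Rightarrow> 'e \<Rightarrow> 'e \<Rightarrow> 'e"
  where "\<Gamma> \<equiv> levi_civita g"

lemma Ck_metric: "Ck_on k U (\<lambda>x. g x u v)"
  using smooth by (simp add: smooth_map_on_def)

lemma metric_has_derivative: "x \<in> U \<Longrightarrow> ((\<lambda>y. g y u v) has_derivative dg x u v) (at x)"
  using Ck_on_has_derivative[OF Ck_metric] .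

lemma linear_left: "x \<in> U \<Longrightarrow> linear (\<lambda>u. g x u v)"
  and linear_right: "x \<in> U \<Longrightarrow> linear (g x u)"
  using bilin by (auto simp: bilinear_def)

text \<open>
  A way to compute derivatives of the metric from identities that hold on \<open>U\<close> only: outside \<open>U\<close> the
  function \<open>g\<close> is arbitrary.
\<close>

lemma dg_eqI:
  assumes "x \<in> U" "((\<lambda>y. f y) has_derivative D) (at x)" "\<And>y. y \<in> U \<Longrightarrow> f y = g y u v"
  shows "dg x u v z = D z"
proof -
  have "((\<lambda>y. g y u v) has_derivative D) (at x)"
    by (rule has_derivative_transform_within_open[OF assms(2) open_U assms(1,3)])
  from frechet_derivative_at[OF this] show ?thesis by metis
qed

lemma dg_bilinear: assumes x: "x \<in> U" shows "bilinear (\<lambda>u v. dg x u v z)"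
  unfolding bilinear_def
proof (intro allI conjI linearI)
  fix u u' v v' and r :: real
  note l = linear_add[OF linear_left] linear_add[OF linear_right]
    linear_scale[OF linear_left] linear_scale[OF linear_right]
  show "dg x (u + u') v z = dg x u v z + dg x u' v z"
    by (rule dg_eqI[OF x has_derivative_add[OF metric_has_derivative metric_has_derivative]])
       (auto simp: x l)
  show "dg x u (v + v') z = dg x u v z + dg x u v' z"
    by (rule dg_eqI[OF x has_derivative_add[OF metric_has_derivative metric_has_derivative]])
       (auto simp: x l)
  show "dg x (r *\<^sub>R u) v z = r *\<^sub>R dg x u v z"
    by (rule dg_eqI[OF x has_derivative_scaleR_right[OF metric_has_derivative]])
       (auto simp: x l)
  show "dg x u (r *\<^sub>R v) z = r *\<^sub>R dg x u v z"
    by (rule dg_eqI[OF x has_derivative_scaleR_right[OF metric_has_derivative]])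
       (auto simp: x l)
qed

lemma dg_symm: "x \<in> U \<Longrightarrow> dg x u v z = dg x v u z"
  by (rule dg_eqI[OF _ metric_has_derivative]) (auto simp: symm[of _ u v])

lemma dg_linear: "x \<in> U \<Longrightarrow> linear (dg x u v)"
  by (rule dderiv_linear[OF Ck_metric])

lemma dg_linear1: "x \<in> U \<Longrightarrow> linear (\<lambda>u. dg x u v z)"
  and dg_linear2: "x \<in> U \<Longrightarrow> linear (\<lambda>v. dg x u v z)"
  using dg_bilinear by (auto simp: bilinear_def)

lemma koszul_linear: "x \<in> U \<Longrightarrow> linear (koszul g x u v)"
  unfolding koszul_def
  by (intro linear_compose_add linear_compose_sub dg_linear dg_linear2)

lemma koszul_linear1: "x \<in> U \<Longrightarrow> linear (\<lambda>u. koszul g x u v z)"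
  unfolding koszul_def
  by (intro linear_compose_add linear_compose_sub dg_linear dg_linear1)

lemma koszul_symm: "x \<in> U \<Longrightarrow> koszul g x u v z = koszul g x v u z"
  unfolding koszul_def using dg_symm[of x u v z] by simp

lemma metric_eqI:
  assumes x: "x \<in> U" and "\<And>z. g x w z = g x w' z" shows "w = w'"
proof (rule ccontr)
  assume "w \<noteq> w'"
  then have "g x (w - w') (w - w') > 0" using pos[OF x] by simp
  then show False using assms(2) by (simp add: linear_diff[OF linear_left[OF x]])
qed

text \<open>
  The linear map \<open>T\<close> with \<open>T w \<bullet> z = g x w z\<close> is injective because \<open>g x\<close> is positive definite,
  hence surjective.
\<close>

lemma riesz:
  assumes x: "x \<in> U" and K: "linear K"
  obtains w where "\<And>z. g x w z = K z"
proof -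
  define T where "T w = (\<Sum>b\<in>Basis. g x w b *\<^sub>R b)" for w
  have T: "T w \<bullet> z = g x w z" for w z
    using linear_expand[OF linear_right[OF x, of w], of z]
    by (simp add: T_def inner_sum_right inner_commute[of _ z] mult.commute)
  have "linear T"
    unfolding T_def
    by (rule linearI)
       (simp_all add: linear_add[OF linear_left[OF x]] linear_scale[OF linear_left[OF x]]
          scaleR_add_left sum.distrib scaleR_sum_right)
  moreover have "inj T"
    by (rule injI, rule metric_eqI[OF x]) (metis T)
  ultimately have "surj T" using linear_injective_imp_surjective by blast
  then obtain w where w: "T w = (\<Sum>b\<in>Basis. K b *\<^sub>R b)" by (metis surjD)
  have "g x w z = K z" for z
    using linear_expand[OF K, of z] unfolding T[symmetric] w
    by (simp add: inner_sum_right inner_commute[of _ z] mult.commute)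
  then show ?thesis by (rule that)
qed

lemma levi_civita_unique:
  assumes "x \<in> U" "\<And>z. 2 * g x w z = koszul g x u v z"
  shows "\<Gamma> x u v = w"
  unfolding levi_civita_def
proof (rule the_equality)
  fix w' assume "\<forall>z. 2 * g x w' z = koszul g x u v z"
  with assms(2) have "g x w' z = g x w z" for z by (metis mult_cancel_left zero_neq_numeral)
  then show "w' = w" by (rule metric_eqI[OF assms(1)])
qed (use assms(2) in blast)

lemma levi_civita_koszul:
  assumes "x \<in> U" shows "2 * g x (\<Gamma> x u v) z = koszul g x u v z"
proof -
  have "linear (\<lambda>z. koszul g x u v z / 2)"
    using linear_compose_scale_right[OF koszul_linear[OF assms, of u v], of "1/2"] by simp
  from riesz[OF assms this] obtain w where w: "\<And>z. g x w z = koszul g x u v z / 2" by blast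
  have eq: "2 * g x w z = koszul g x u v z" for z using w[of z] by simp
  show ?thesis unfolding levi_civita_unique[OF assms eq] by (rule eq)
qed

lemma levi_civita_symm: "x \<in> U \<Longrightarrow> \<Gamma> x u v = \<Gamma> x v u"
  by (rule levi_civita_unique) (simp_all add: levi_civita_koszul koszul_symm[of x u v])

lemma levi_civita_bilinear: assumes x: "x \<in> U" shows "bilinear (\<Gamma> x)"
proof -
  have l: "linear (\<lambda>u. \<Gamma> x u v)" for v
  proof (rule linearI)
    fix u u' and r :: real
    show "\<Gamma> x (u + u') v = \<Gamma> x u v + \<Gamma> x u' v"
      by (rule levi_civita_unique[OF x])
         (simp add: linear_add[OF linear_left[OF x]] linear_add[OF koszul_linear1[OF x]]
            levi_civita_koszul[OF x] distrib_left)
    show "\<Gamma> x (r *\<^sub>R u) v = r *\<^sub>R \<Gamma> x u v"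
      by (rule levi_civita_unique[OF x])
         (use levi_civita_koszul[OF x] in \<open>simp add: linear_scale[OF linear_left[OF x]]
            linear_scale[OF koszul_linear1[OF x]] mult.left_commute[of 2]\<close>)
  qed
  then show ?thesis
    using levi_civita_symm[OF x] by (simp add: bilinear_def)
qed

text \<open>
  The connection is metric: adding the Koszul formula to the one with \<open>v\<close> and \<open>z\<close> exchanged, all
  derivatives of the metric cancel except the one in direction \<open>u\<close>.
\<close>

lemma levi_civita_metric:
  assumes x: "x \<in> U"
  shows "g x (\<Gamma> x u v) z + g x v (\<Gamma> x u z) = dg x v z u"
proof -
  have "2 * g x (\<Gamma> x u v) z + 2 * g x (\<Gamma> x u z) v = 2 * dg x v z u"
    unfolding levi_civita_koszul[OF x] koszul_def
    using dg_symm[OF x, of v z] by simp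
  then show ?thesis using symm[OF x, of v] by simp
qed

text \<open>
  The product rule \<open>\<langle>V, W\<rangle>' = \<langle>\<nabla>V, W\<rangle> + \<langle>V, \<nabla>W\<rangle>\<close> for vector fields along a curve: the derivative of the
  metric tensor itself is absorbed by the two Christoffel terms.
\<close>

lemma has_derivative_metric_along:
  assumes y: "y s \<in> U" "(y has_vector_derivative y') (at s within I)"
    and V: "(V has_vector_derivative V') (at s within I)"
    and W: "(W has_vector_derivative W') (at s within I)" and s: "s \<in> I"
  shows "((\<lambda>r. g (y r) (V r) (W r)) has_real_derivative
     g (y s) (V' + \<Gamma> (y s) y' (V s)) (W s) + g (y s) (V s) (W' + \<Gamma> (y s) y' (W s))) (at s within I)"
proof -
  have G: "((\<lambda>r. g (y r) b b') has_real_derivative dg (y s) b b' y') (at s within I)" for b b'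
  proof -
    have "((\<lambda>r. g (y r) b b') has_derivative (\<lambda>r. dg (y s) b b' (r *\<^sub>R y'))) (at s within I)"
      by (rule has_derivative_compose[OF y(2)[unfolded has_vector_derivative_def] metric_has_derivative[OF y(1)]])
    then show ?thesis
      by (simp add: has_field_derivative_def linear_scale[OF dg_linear[OF y(1)]] mult.commute[of _ "dg _ _ _ _"])
  qed
  have c: "((\<lambda>r. V r \<bullet> b) has_real_derivative V' \<bullet> b) (at s within I)"
          "((\<lambda>r. W r \<bullet> b) has_real_derivative W' \<bullet> b) (at s within I)" for b
    using bounded_linear.has_vector_derivative[OF bounded_linear_inner_left V]
      bounded_linear.has_vector_derivative[OF bounded_linear_inner_left W]
    by (simp_all add: has_real_derivative_iff_has_vector_derivative)
  have "((\<lambda>r. \<Sum>b\<in>Basis. \<Sum>b'\<in>Basis. ((V r \<bullet> b) * (W r \<bullet> b')) * g (y r) b b') has_real_derivative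
     (\<Sum>b\<in>Basis. \<Sum>b'\<in>Basis. ((V' \<bullet> b) * (W s \<bullet> b')) * g (y s) b b'
        + ((V s \<bullet> b) * (W' \<bullet> b')) * g (y s) b b'
        + ((V s \<bullet> b) * (W s \<bullet> b')) * dg (y s) b b' y')) (at s within I)" (is "(?L has_real_derivative ?D) _")
  proof (intro DERIV_sum)
    fix b b' :: 'e
    show "((\<lambda>r. ((V r \<bullet> b) * (W r \<bullet> b')) * g (y r) b b') has_real_derivative
      ((V' \<bullet> b) * (W s \<bullet> b')) * g (y s) b b'
        + ((V s \<bullet> b) * (W' \<bullet> b')) * g (y s) b b'
        + ((V s \<bullet> b) * (W s \<bullet> b')) * dg (y s) b b' y') (at s within I)"
      by (rule DERIV_mult[OF DERIV_mult[OF c] G, THEN DERIV_cong]) (simp add: algebra_simps)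
  qed
  moreover have "?D = g (y s) V' (W s) + g (y s) (V s) W' + dg (y s) (V s) (W s) y'"
    unfolding sum.distrib
    unfolding bilinear_expand[OF bilin[OF y(1)], of V' "W s"] bilinear_expand[OF bilin[OF y(1)], of "V s" W']
      bilinear_expand[OF dg_bilinear[OF y(1)], of "V s" "W s"]
    by simp
  moreover have "\<dots> = g (y s) (V' + \<Gamma> (y s) y' (V s)) (W s) + g (y s) (V s) (W' + \<Gamma> (y s) y' (W s))"
    using levi_civita_metric[OF y(1), of y' "V s" "W s"]
    by (simp add: linear_add[OF linear_left[OF y(1)]] linear_add[OF linear_right[OF y(1)]])
  ultimately have D: "(?L has_real_derivative
     g (y s) (V' + \<Gamma> (y s) y' (V s)) (W s) + g (y s) (V s) (W' + \<Gamma> (y s) y' (W s))) (at s within I)"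
    by simp
  have "continuous (at s within I) y" by (rule has_vector_derivative_continuous[OF y(2)])
  then have ev: "eventually (\<lambda>r. y r \<in> U) (at s within I)"
    unfolding continuous_within using topological_tendstoD[OF _ open_U y(1)] by blast
  have ex: "?L r = g (y r) (V r) (W r)" if "y r \<in> U" for r
    using bilinear_expand[OF bilin[OF that], of "V r" "W r"] by simp
  show ?thesis
    using D unfolding has_field_derivative_def
    by (rule has_derivative_transform_eventually)
       (use ev s y(1) in \<open>auto elim!: eventually_mono simp: ex\<close>)
qed

text \<open>
  The metric attains a positive minimum on a compact set of unit vectors over a ball.
\<close>

lemma metric_coercive:
  assumes x: "x \<in> U"
  obtains r c where "r > 0" "c > 0" "cball x r \<subseteq> U" "\<And>y z. y \<in> cball x r \<Longrightarrow> c * (norm z)\<^sup>2 \<le> g y z z"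
proof -
  obtain r where r: "r > 0" "cball x r \<subseteq> U" using open_U x open_contains_cball by blast
  let ?S = "cball x r \<times> sphere (0::'e) 1"
  have "continuous_on ?S (\<lambda>p. \<Sum>b\<in>Basis. \<Sum>b'\<in>Basis. ((snd p \<bullet> b) * (snd p \<bullet> b')) * g (fst p) b b')"
  proof (intro continuous_intros)
    fix b b' :: 'e
    show "continuous_on ?S (\<lambda>p. g (fst p) b b')"
      by (rule continuous_on_compose2[OF Ck_on_continuous[OF Ck_metric[of 0]]])
         (use r in \<open>auto intro!: continuous_intros\<close>)
  qed
  moreover have "(\<Sum>b\<in>Basis. \<Sum>b'\<in>Basis. ((snd p \<bullet> b) * (snd p \<bullet> b')) * g (fst p) b b') = g (fst p) (snd p) (snd p)"
    if "p \<in> ?S" for p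
  proof -
    have "fst p \<in> U" using that r by auto
    from bilinear_expand[OF bilin[OF this], of "snd p" "snd p"] show ?thesis by simp
  qed
  ultimately have cont: "continuous_on ?S (\<lambda>p. g (fst p) (snd p) (snd p))"
    using continuous_on_cong by (smt (verit, best))
  have "compact ?S" by (intro compact_Times) auto
  moreover obtain b :: 'e where "b \<in> Basis" using nonempty_Basis by blast
  then have "(x, b) \<in> ?S" using r by (simp add: norm_Basis)
  ultimately obtain p where p: "p \<in> ?S" and min: "\<And>q. q \<in> ?S \<Longrightarrow> g (fst p) (snd p) (snd p) \<le> g (fst q) (snd q) (snd q)"
    using continuous_attains_inf[OF _ _ cont] by blast
  define c where "c = g (fst p) (snd p) (snd p)"
  have c: "c > 0" unfolding c_def using p r by (intro pos) auto
  show ?thesis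
  proof (rule that[OF r(1) c r(2)])
    fix y z assume y: "y \<in> cball x r"
    then have yU: "y \<in> U" using r by auto
    show "c * (norm z)\<^sup>2 \<le> g y z z"
    proof (cases "z = 0")
      case True
      then show ?thesis using linear_0[OF linear_left[OF yU]] by simp
    next
      case False
      define e where "e = z /\<^sub>R norm z"
      have ne: "norm e = 1" and ze: "z = norm z *\<^sub>R e" using False by (auto simp: e_def)
      have "g y z z = (norm z)\<^sup>2 * g y e e"
        by (subst (1 2) ze)
           (simp only: linear_scale[OF linear_left[OF yU]] linear_scale[OF linear_right[OF yU]],
            simp add: power2_eq_square)
      moreover have "c \<le> g y e e" using min[of "(y, e)"] y ne by (simp add: c_def)
      ultimately show ?thesis by (simp add: mult_right_mono mult.commute[of "(norm z)\<^sup>2"])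
    qed
  qed
qed

text \<open>
  The Christoffel symbols solve the linear equations \<open>2 g(w, z) = K(z)\<close>, whose coefficients are Lipschitz. Let
  \<open>\<Delta>\<close> be the difference of the solutions at \<open>y\<close> and \<open>y'\<close>. Testing both equations with \<open>z = \<Delta>\<close> bounds \<open>g(\<Delta>, \<Delta>)\<close>, and
  hence \<open>|\<Delta>|\<^sup>2\<close>, by a multiple of \<open>dist y y' |\<Delta>|\<close>.
\<close>

lemma levi_civita_locally_lipschitz:
  assumes x: "x \<in> U"
  shows "locally_lipschitz_at (\<lambda>y. \<Gamma> y u v) x"
proof -
  obtain r0 c where r0: "r0 > 0" "c > 0" "cball x r0 \<subseteq> U"
    and coer: "\<And>y z. y \<in> cball x r0 \<Longrightarrow> c * (norm z)\<^sup>2 \<le> g y z z"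
    using metric_coercive[OF x] by blast
  have "locally_lipschitz_at (\<lambda>y. g y (fst p) (snd p)) x" if "p \<in> Basis \<times> Basis" for p
    by (rule Ck_on_locally_lipschitz[OF Ck_metric open_U x])
  then obtain r1 L1 where r1: "r1 > 0" "L1 \<ge> 0"
    and Lg: "\<And>p s. p \<in> Basis \<times> Basis \<Longrightarrow> s \<le> r1 \<Longrightarrow> L1-lipschitz_on (cball x s) (\<lambda>y. g y (fst p) (snd p))"
    using locally_lipschitz_at_finite[of "Basis \<times> Basis" "\<lambda>p y. g y (fst p) (snd p)" x]
    by (metis finite_Basis finite_cartesian_product)
  have Ld: "locally_lipschitz_at (\<lambda>y. dg y p q w) x" for p q w
    by (rule Ck_on_locally_lipschitz[OF Ck_on_dderiv[OF Ck_metric] open_U x])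
  have "locally_lipschitz_at (\<lambda>y. koszul g y u v b) x" for b
  proof -
    have "locally_lipschitz_at (\<lambda>y. dg y v b u + dg y u b v + (- 1) *\<^sub>R dg y u v b) x"
      by (intro locally_lipschitz_at_add locally_lipschitz_at_scaleR Ld locally_lipschitz_at_const)
    then show ?thesis by (simp add: koszul_def)
  qed
  then obtain r2 L2 where r2: "r2 > 0" "L2 \<ge> 0"
    and LK: "\<And>b s. b \<in> Basis \<Longrightarrow> s \<le> r2 \<Longrightarrow> L2-lipschitz_on (cball x s) (\<lambda>y. koszul g y u v b)"
    using locally_lipschitz_at_finite[of Basis "\<lambda>b y. koszul g y u v b" x]
    by (metis finite_Basis)
  define r where "r = min r0 (min r1 r2)"
  have r: "r > 0" "r \<le> r0" "r \<le> r1" "r \<le> r2" using r0 r1 r2 by (auto simp: r_def)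
  define n where "n = real DIM('e)"
  have n: "n > 0" by (simp add: n_def)
  define B where "B = (\<Sum>b\<in>Basis. \<bar>koszul g x u v b\<bar>) + L2 * r"
  have inU: "y \<in> U" if "y \<in> cball x r" for y using that r r0(3) by auto
  have coer': "c * (norm z)\<^sup>2 \<le> g y z z" if "y \<in> cball x r" for y z
    by (rule coer) (use that r in auto)
  have KB: "\<bar>koszul g y u v b\<bar> \<le> B" if "y \<in> cball x r" "b \<in> Basis" for y b
  proof -
    have "dist (koszul g y u v b) (koszul g x u v b) \<le> L2 * dist y x"
      by (rule lipschitz_onD[OF LK[OF that(2) r(4)] that(1)]) (use r in simp)
    also have "\<dots> \<le> L2 * r" using that r2 by (intro mult_left_mono) (auto simp: dist_commute)
    moreover have "\<bar>koszul g x u v b\<bar> \<le> (\<Sum>b\<in>Basis. \<bar>koszul g x u v b\<bar>)"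
      using that(2) by (intro member_le_sum) auto
    ultimately show ?thesis by (simp add: B_def dist_real_def)
  qed
  have Kb: "\<bar>koszul g y u v z\<bar> \<le> n * B * norm z" if y: "y \<in> cball x r" for y z
    using sum_Basis_bound[of "koszul g y u v" B z] KB[OF y] linear_expand[OF koszul_linear[OF inU[OF y]], of u v z]
    by (simp add: n_def)
  \<comment> \<open>A bound on the Christoffel symbols over the ball, from testing the equation with its own solution.\<close>
  define W where "W = n * B / c"
  have W: "norm (\<Gamma> y u v) \<le> W" if y: "y \<in> cball x r" for y
  proof (cases "\<Gamma> y u v = 0")
    case True
    have "B \<ge> 0" unfolding B_def using r r2 by (intro add_nonneg_nonneg sum_nonneg) auto
    then show ?thesis using True r0 n by (simp add: W_def)
  next
    case False
    let ?w = "\<Gamma> y u v"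
    have "2 * (c * (norm ?w)\<^sup>2) \<le> 2 * g y ?w ?w" using coer'[OF y] by simp
    also have "\<dots> \<le> n * B * norm ?w"
      unfolding levi_civita_koszul[OF inU[OF y]] using Kb[OF y, of ?w] by simp
    finally have "2 * (c * norm ?w) * norm ?w \<le> n * B * norm ?w" by (simp add: power2_eq_square)
    then have "2 * (c * norm ?w) \<le> n * B" using False by simp
    moreover have "c * norm ?w \<ge> 0" using r0 by simp
    ultimately have "c * norm ?w \<le> n * B" by linarith
    then show ?thesis using r0 by (simp add: W_def field_simps)
  qed
  have gd: "\<bar>g y w z - g y' w z\<bar> \<le> n * (n * (L1 * dist y y') * norm z) * norm w"
    if y: "y \<in> cball x r" "y' \<in> cball x r" for y y' w z
  proof -
    have 1: "\<bar>g y b z - g y' b z\<bar> \<le> n * (L1 * dist y y') * norm z" if b: "b \<in> Basis" for b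
    proof -
      have "\<bar>g y b b' - g y' b b'\<bar> \<le> L1 * dist y y'" if "b' \<in> Basis" for b'
        using lipschitz_onD[OF Lg[of "(b, b')" r] y] b that r by (simp add: dist_real_def)
      from sum_Basis_bound[of "\<lambda>b'. g y b b' - g y' b b'", OF this, of z] show ?thesis
        using linear_expand[OF linear_right[OF inU[OF y(1)]], of b z]
          linear_expand[OF linear_right[OF inU[OF y(2)]], of b z]
        by (simp add: n_def right_diff_distrib sum_subtractf)
    qed
    from sum_Basis_bound[of "\<lambda>b. g y b z - g y' b z", OF this, of w] show ?thesis
      using linear_expand[OF linear_left[OF inU[OF y(1)]], of w z]
        linear_expand[OF linear_left[OF inU[OF y(2)]], of w z]
      by (simp add: n_def right_diff_distrib sum_subtractf)
  qed
  have Kd: "\<bar>koszul g y u v z - koszul g y' u v z\<bar> \<le> n * (L2 * dist y y') * norm z"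
    if y: "y \<in> cball x r" "y' \<in> cball x r" for y y' z
  proof -
    have "\<bar>koszul g y u v b - koszul g y' u v b\<bar> \<le> L2 * dist y y'" if "b \<in> Basis" for b
      using lipschitz_onD[OF LK[OF that r(4)] y] by (simp add: dist_real_def)
    from sum_Basis_bound[of "\<lambda>b. koszul g y u v b - koszul g y' u v b", OF this, of z] show ?thesis
      using linear_expand[OF koszul_linear[OF inU[OF y(1)]], of u v z]
        linear_expand[OF koszul_linear[OF inU[OF y(2)]], of u v z]
      by (simp add: n_def right_diff_distrib sum_subtractf)
  qed
  define C where "C = (n * L2 + n * n * L1 * W) / c"
  show ?thesis
  proof (rule locally_lipschitz_atI[OF r(1)])
    fix y y' assume y: "y \<in> cball x r" "y' \<in> cball x r"
    let ?w = "\<Gamma> y u v" and ?w' = "\<Gamma> y' u v"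
    define \<Delta> where "\<Delta> = ?w - ?w'"
    have W0: "W \<ge> 0" using order_trans[OF norm_ge_zero W[OF y(1)]] .
    have eq: "2 * g y \<Delta> \<Delta> = (koszul g y u v \<Delta> - koszul g y' u v \<Delta>) - 2 * (g y ?w' \<Delta> - g y' ?w' \<Delta>)"
    proof -
      have "2 * g y \<Delta> \<Delta> = 2 * g y ?w \<Delta> - 2 * g y ?w' \<Delta>"
        using linear_diff[OF linear_left[OF inU[OF y(1)]], of ?w ?w' \<Delta>]
        by (simp only: \<Delta>_def[symmetric] right_diff_distrib)
      moreover have "2 * g y ?w \<Delta> = koszul g y u v \<Delta>" "2 * g y' ?w' \<Delta> = koszul g y' u v \<Delta>"
        using levi_civita_koszul inU y by auto
      ultimately show ?thesis by simp
    qed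
    have "2 * (c * (norm \<Delta>)\<^sup>2) \<le> 2 * g y \<Delta> \<Delta>" using coer'[OF y(1)] by simp
    also have "\<dots> \<le> \<bar>koszul g y u v \<Delta> - koszul g y' u v \<Delta>\<bar> + 2 * \<bar>g y ?w' \<Delta> - g y' ?w' \<Delta>\<bar>"
    proof -
      have "a - 2 * b \<le> \<bar>a\<bar> + 2 * \<bar>b\<bar>" for a b :: real by linarith
      then show ?thesis unfolding eq .
    qed
    also have "\<dots> \<le> n * (L2 * dist y y') * norm \<Delta> + 2 * (n * (n * (L1 * dist y y') * norm \<Delta>) * W)"
    proof (intro add_mono Kd[OF y] mult_left_mono order_trans[OF gd[OF y]])
      show "norm ?w' \<le> W" by (rule W[OF y(2)])
    qed (use n r1 in auto)
    also have "\<dots> \<le> 2 * (n * (L2 * dist y y') * norm \<Delta>) + 2 * (n * (n * (L1 * dist y y') * norm \<Delta>) * W)"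
      using n r2 by simp
    finally have "(c * norm \<Delta>) * norm \<Delta> \<le> ((n * L2 + n * n * L1 * W) * dist y y') * norm \<Delta>"
      by (simp add: power2_eq_square algebra_simps)
    then have "c * norm \<Delta> \<le> (n * L2 + n * n * L1 * W) * dist y y'"
      using n r1 r2 W0 by (cases "\<Delta> = 0") auto
    then show "dist ?w ?w' \<le> C * dist y y'"
      unfolding C_def dist_norm[of ?w ?w'] \<Delta>_def[symmetric]
      using r0(2) by (simp only: times_divide_eq_left pos_le_divide_eq mult.commute[of _ c])
  qed
qed

lemma levi_civita_continuous: "continuous_on U (\<lambda>y. \<Gamma> y u v)"
  using locally_lipschitz_at_continuous[OF levi_civita_locally_lipschitz] open_U
  by (simp add: continuous_on_eq_continuous_at)

text \<open>
  The geodesic equation \<open>x'' = - \<Gamma>(x', x')\<close> as a first-order system for position and velocity. The vector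
  field is written with the components of \<open>\<Gamma>\<close> in a basis, since \<open>\<Gamma>\<close> need not be bilinear outside \<open>U\<close>.
\<close>

lemma geodesic_exists:
  assumes x: "x0 \<in> U"
  obtains h x v where "h > 0" "x 0 = x0" "v 0 = u"
    "\<And>t. t \<in> {0..h} \<Longrightarrow> x t \<in> U"
    "\<And>t. t \<in> {0..h} \<Longrightarrow> (x has_vector_derivative v t) (at t within {0..h})"
    "\<And>t. t \<in> {0..h} \<Longrightarrow> (v has_vector_derivative - \<Gamma> (x t) (v t) (v t)) (at t within {0..h})"
proof -
  obtain e where e: "e > 0" "cball x0 e \<subseteq> U" using open_U x open_contains_cball by blast
  define F :: "'e \<times> 'e \<Rightarrow> 'e \<times> 'e" where
    "F p = (snd p, (- 1) *\<^sub>R (\<Sum>b\<in>Basis. \<Sum>b'\<in>Basis. (snd p \<bullet> b) *\<^sub>R (snd p \<bullet> b') *\<^sub>R \<Gamma> (fst p) b b'))" for p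
  have li: "locally_lipschitz_at (\<lambda>p::'e \<times> 'e. snd p \<bullet> b) a" for b a
    by (intro locally_lipschitz_at_bounded_linear bounded_linear_inner_left_comp bounded_linear_snd)
  have lG: "locally_lipschitz_at (\<lambda>p::'e \<times> 'e. \<Gamma> (fst p) b b') (x0, u)" for b b'
    by (rule locally_lipschitz_at_compose[OF locally_lipschitz_at_bounded_linear[OF bounded_linear_fst]])
       (simp add: levi_civita_locally_lipschitz[OF x])
  have "locally_lipschitz_at F (x0, u)"
    unfolding F_def[abs_def]
    by (intro locally_lipschitz_at_Pair locally_lipschitz_at_scaleR locally_lipschitz_at_const
        locally_lipschitz_at_sum li lG locally_lipschitz_at_bounded_linear bounded_linear_snd)
  then obtain h z where h: "h > 0" "z 0 = (x0, u)"
    and zin: "\<And>t. t \<in> {0..h} \<Longrightarrow> z t \<in> cball (x0, u) e"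
    and zd: "\<And>t. t \<in> {0..h} \<Longrightarrow> (z has_vector_derivative F (z t)) (at t within {0..h})"
    using picard_lindelof[OF _ e(1)] by metis
  have U: "fst (z t) \<in> U" if "t \<in> {0..h}" for t
  proof -
    have "dist x0 (fst (z t)) \<le> dist (x0, u) (z t)" using dist_fst_le[of "(x0, u)" "z t"] by simp
    then show ?thesis using zin[OF that] e by auto
  qed
  show ?thesis
  proof (rule that[OF h(1), of "\<lambda>t. fst (z t)" "\<lambda>t. snd (z t)"])
    fix t assume t: "t \<in> {0..h}"
    show "((\<lambda>t. fst (z t)) has_vector_derivative snd (z t)) (at t within {0..h})"
      using bounded_linear.has_vector_derivative[OF bounded_linear_fst zd[OF t]] by (simp add: F_def)
    have "((\<lambda>t. snd (z t)) has_vector_derivative snd (F (z t))) (at t within {0..h})"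
      by (rule bounded_linear.has_vector_derivative[OF bounded_linear_snd zd[OF t]])
    moreover have "snd (F (z t)) = - \<Gamma> (fst (z t)) (snd (z t)) (snd (z t))"
      using bilinear_expand[OF levi_civita_bilinear[OF U[OF t]], of "snd (z t)" "snd (z t)"]
      by (simp add: F_def)
    ultimately show "((\<lambda>t. snd (z t)) has_vector_derivative - \<Gamma> (fst (z t)) (snd (z t)) (snd (z t))) (at t within {0..h})"
      by simp
  qed (use h U in auto)
qed

end

section \<open>The second fundamental form of an isometric immersion\<close>

text \<open>
  The covariant derivative in direction \<open>u\<close> of the field \<open>D\<phi> v\<close> along \<open>\<phi>\<close>, for constant \<open>v\<close>. Its
  difference from \<open>D\<phi> (\<Gamma> u v)\<close>, with \<open>\<Gamma>\<close> the connection of the source, is the second fundamental form of an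
  isometric immersion \<open>\<phi>\<close>.
\<close>

definition cov_hessian ::
  "('e::real_normed_vector \<Rightarrow> 'e \<Rightarrow> 'e \<Rightarrow> real) \<Rightarrow> ('n::real_normed_vector \<Rightarrow> 'e) \<Rightarrow> 'n \<Rightarrow> 'n \<Rightarrow> 'n \<Rightarrow> 'e"
  where "cov_hessian g \<phi> x u v =
    dderiv (dderiv \<phi> v) u x + levi_civita g (\<phi> x) (dderiv \<phi> u x) (dderiv \<phi> v x)"

lemma has_vector_derivative_compose_Ck:
  assumes \<phi>: "Ck_on (Suc k) S \<phi>" "x s \<in> S" and x: "(x has_vector_derivative x') (at s within I)"
  shows "((\<lambda>r. \<phi> (x r)) has_vector_derivative dderiv \<phi> x' (x s)) (at s within I)"
proof -
  have "((\<lambda>r. \<phi> (x r)) has_derivative (\<lambda>r. dderiv \<phi> (r *\<^sub>R x') (x s))) (at s within I)"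
    by (rule has_derivative_compose[OF x[unfolded has_vector_derivative_def] Ck_on_has_derivative[OF \<phi>]])
  then show ?thesis
    by (simp add: has_vector_derivative_def linear_scale[OF dderiv_linear[OF \<phi>]])
qed

lemma eventually_in_open:
  assumes "(x has_vector_derivative x') (at s within I)" "open S" "x s \<in> S"
  shows "eventually (\<lambda>r. x r \<in> S) (at s within I)"
  using has_vector_derivative_continuous[OF assms(1)] topological_tendstoD[OF _ assms(2,3)]
  unfolding continuous_within by blast

lemma has_vector_derivative_dderiv_along:
  fixes \<phi> :: "'n::euclidean_space \<Rightarrow> 'e::real_normed_vector"
  assumes \<phi>: "Ck_on (Suc (Suc k)) S \<phi>" and S: "open S" "x s \<in> S" and s: "s \<in> I"
    and x: "(x has_vector_derivative x') (at s within I)"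
    and v: "(v has_vector_derivative v') (at s within I)"
  shows "((\<lambda>r. dderiv \<phi> (v r) (x r)) has_vector_derivative
      dderiv (dderiv \<phi> (v s)) x' (x s) + dderiv \<phi> v' (x s)) (at s within I)"
proof -
  have \<phi>1: "Ck_on (Suc k) S (dderiv \<phi> b)" for b using \<phi> by simp
  have c: "((\<lambda>r. v r \<bullet> b) has_real_derivative v' \<bullet> b) (at s within I)" for b
    using bounded_linear.has_vector_derivative[OF bounded_linear_inner_left v]
    by (simp add: has_real_derivative_iff_has_vector_derivative)
  have D: "((\<lambda>r. \<Sum>b\<in>Basis. (v r \<bullet> b) *\<^sub>R dderiv \<phi> b (x r)) has_vector_derivative
     (\<Sum>b\<in>Basis. (v s \<bullet> b) *\<^sub>R dderiv (dderiv \<phi> b) x' (x s) + (v' \<bullet> b) *\<^sub>R dderiv \<phi> b (x s))) (at s within I)"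
    by (intro has_vector_derivative_sum has_vector_derivative_scaleR c
        has_vector_derivative_compose_Ck[OF \<phi>1 S(2) x])
  have lin: "linear (\<lambda>v. dderiv \<phi> v y)" if "y \<in> S" for y using dderiv_linear[OF \<phi> that] .
  have eq: "(\<Sum>b\<in>Basis. (v r \<bullet> b) *\<^sub>R dderiv \<phi> b (x r)) = dderiv \<phi> (v r) (x r)" if "x r \<in> S" for r
    using linear_expand[OF lin[OF that], of "v r"] by simp
  have dd: "dderiv (dderiv \<phi> (v s)) x' (x s) = (\<Sum>b\<in>Basis. (v s \<bullet> b) *\<^sub>R dderiv (dderiv \<phi> b) x' (x s))"
  proof -
    have "((\<lambda>y. \<Sum>b\<in>Basis. (v s \<bullet> b) *\<^sub>R dderiv \<phi> b y) has_derivative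
        (\<lambda>z. \<Sum>b\<in>Basis. (v s \<bullet> b) *\<^sub>R dderiv (dderiv \<phi> b) z (x s))) (at (x s))"
      by (intro has_derivative_sum has_derivative_scaleR_right Ck_on_has_derivative[OF \<phi>1 S(2)])
    then have "(dderiv \<phi> (v s) has_derivative
        (\<lambda>z. \<Sum>b\<in>Basis. (v s \<bullet> b) *\<^sub>R dderiv (dderiv \<phi> b) z (x s))) (at (x s))"
      by (rule has_derivative_transform_within_open[OF _ S])
         (simp add: linear_expand[OF lin, of _ "v s"])
    from fun_cong[OF frechet_derivative_at[OF this], of x'] show ?thesis by (rule sym)
  qed
  have "((\<lambda>r. dderiv \<phi> (v r) (x r)) has_vector_derivative
     (\<Sum>b\<in>Basis. (v s \<bullet> b) *\<^sub>R dderiv (dderiv \<phi> b) x' (x s) + (v' \<bullet> b) *\<^sub>R dderiv \<phi> b (x s))) (at s within I)"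
    using D unfolding has_vector_derivative_def
    by (rule has_derivative_transform_eventually)
       (use eventually_in_open[OF x S] S(2) s in \<open>auto elim!: eventually_mono simp: eq\<close>)
  then show ?thesis
    unfolding dd linear_expand[OF lin[OF S(2)], of v'] by (simp add: sum.distrib)
qed

text \<open>
  The second fundamental form is orthogonal to the image. Differentiating the isometry relation shows that
  \<open>K u v z = \<langle>cov_hessian u v, D\<phi> z\<rangle>\<close> satisfies \<open>K u v z + K u z v = D\<^sub>u g(v, z)\<close>; it is symmetric in \<open>u\<close> and \<open>v\<close>,
  and these two properties determine it by the computation behind the Koszul formula.
\<close>

lemma isometry_cov_hessian_tangential:
  fixes \<phi> :: "'n::euclidean_space \<Rightarrow> 'e::euclidean_space"
  assumes g: "smooth_metric U g" and g': "smooth_metric U' g'"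
    and S: "open S" "S \<subseteq> U" "\<phi> ` S \<subseteq> U'" and \<phi>: "Ck_on (Suc (Suc 0)) S \<phi>"
    and iso: "\<And>x u v. x \<in> S \<Longrightarrow> g' (\<phi> x) (dderiv \<phi> u x) (dderiv \<phi> v x) = g x u v"
    and x: "x \<in> S"
  shows "g' (\<phi> x) (cov_hessian g' \<phi> x u v) (dderiv \<phi> z x) = g x (levi_civita g x u v) z"
proof -
  interpret N: smooth_metric U g by (rule g)
  interpret M: smooth_metric U' g' by (rule g')
  have xU: "x \<in> U" and yU: "\<phi> x \<in> U'" using x S by auto
  let ?K = "\<lambda>u v z. g' (\<phi> x) (cov_hessian g' \<phi> x u v) (dderiv \<phi> z x)"
  have sum: "?K u v z + ?K u z v = N.dg x v z u" for u v z
  proof -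
    let ?c = "\<lambda>r::real. x + r *\<^sub>R u"
    have c: "(?c has_vector_derivative u) (at 0 within UNIV)"
      by (auto intro!: derivative_eq_intros)
    have c0: "?c 0 \<in> S" using x by simp
    have V: "((\<lambda>r. dderiv \<phi> v (?c r)) has_vector_derivative dderiv (dderiv \<phi> v) u x) (at 0 within UNIV)" for v
      using has_vector_derivative_compose_Ck[of 0 S "dderiv \<phi> v" ?c, OF _ c0 c] \<phi> by simp
    have y: "((\<lambda>r. \<phi> (?c r)) has_vector_derivative dderiv \<phi> u x) (at 0 within UNIV)"
      using has_vector_derivative_compose_Ck[of _ S \<phi> ?c, OF \<phi> c0 c] by simp
    have yU0: "\<phi> (?c 0) \<in> U'" using yU by simp
    have "((\<lambda>r. g' (\<phi> (?c r)) (dderiv \<phi> v (?c r)) (dderiv \<phi> z (?c r))) has_real_derivative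
       ?K u v z + ?K u z v) (at 0)"
      using M.has_derivative_metric_along[of "\<lambda>r. \<phi> (?c r)" 0, OF yU0 y V[of v] V[of z]]
      unfolding cov_hessian_def
      using M.symm[OF yU, of "dderiv \<phi> v x" "dderiv (dderiv \<phi> z) u x + levi_civita g' (\<phi> x) (dderiv \<phi> u x) (dderiv \<phi> z x)"]
      by simp
    moreover have "((\<lambda>r. g (?c r) v z) has_real_derivative N.dg x v z u) (at 0)"
      using has_vector_derivative_compose_Ck[of _ U "\<lambda>y. g y v z" ?c, OF N.Ck_metric _ c] xU
      by (simp add: has_real_derivative_iff_has_vector_derivative)
    then have "((\<lambda>r. g' (\<phi> (?c r)) (dderiv \<phi> v (?c r)) (dderiv \<phi> z (?c r))) has_real_derivative
       N.dg x v z u) (at 0)"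
      unfolding has_field_derivative_def
      by (rule has_derivative_transform_eventually)
         (use eventually_in_open[OF c S(1) c0] in \<open>auto elim!: eventually_mono simp: iso iso[OF x]\<close>)
    ultimately show ?thesis by (rule DERIV_unique)
  qed
  have symm: "?K u v z = ?K v u z" for u v z
    unfolding cov_hessian_def using dderiv_commute[OF \<phi> S(1) x, of u v] M.levi_civita_symm[OF yU] by metis
  have "2 * ?K u v z = koszul g x u v z"
    unfolding koszul_def
    using sum[of u v z] sum[of v u z] sum[of z u v] symm[of u v z] symm[of u z v] symm[of v z u] by linarith
  then show ?thesis using N.levi_civita_koszul[OF xU, of u v z] by simp
qed

lemma cov_hessian_symm:
  fixes \<phi> :: "'n::euclidean_space \<Rightarrow> 'e::euclidean_space"
  assumes "smooth_metric U' g'" "open S" "\<phi> ` S \<subseteq> U'" "Ck_on (Suc (Suc 0)) S \<phi>" "x \<in> S"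
  shows "cov_hessian g' \<phi> x u v = cov_hessian g' \<phi> x v u"
  unfolding cov_hessian_def
  using dderiv_commute[OF assms(4,2,5), of u v] smooth_metric.levi_civita_symm[OF assms(1), of "\<phi> x"] assms(3,5)
  by (metis image_subset_iff)

lemma cov_hessian_linear:
  fixes \<phi> :: "'n::euclidean_space \<Rightarrow> 'e::euclidean_space"
  assumes g': "smooth_metric U' g'" and S: "open S" "\<phi> ` S \<subseteq> U'"
    and \<phi>: "Ck_on (Suc (Suc 0)) S \<phi>" and x: "x \<in> S"
  shows "linear (\<lambda>u. cov_hessian g' \<phi> x u v)"
proof -
  have 1: "linear (\<lambda>u. levi_civita g' (\<phi> x) u (dderiv \<phi> v x))"
    using smooth_metric.levi_civita_bilinear[OF g', of "\<phi> x"] x S(2) by (auto simp: bilinear_def)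
  have "linear (\<lambda>u. levi_civita g' (\<phi> x) (dderiv \<phi> u x) (dderiv \<phi> v x))"
    using linear_compose[OF dderiv_linear[OF \<phi> x] 1] by (simp add: o_def)
  moreover have "linear (\<lambda>u. dderiv (dderiv \<phi> v) u x)"
    by (rule dderiv_linear[OF Ck_on_dderiv[OF \<phi>] x])
  ultimately show ?thesis unfolding cov_hessian_def by (intro linear_compose_add)
qed

text \<open>
  Two symmetric bilinear maps that agree on the diagonal are equal.
\<close>

lemma cov_hessian_polarize:
  fixes \<phi> :: "'n::euclidean_space \<Rightarrow> 'e::euclidean_space"
  assumes g: "smooth_metric U g" and g': "smooth_metric U' g'"
    and S: "open S" "S \<subseteq> U" "\<phi> ` S \<subseteq> U'" and \<phi>: "Ck_on (Suc (Suc 0)) S \<phi>" and x: "x \<in> S"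
    and diag: "\<And>u. cov_hessian g' \<phi> x u u = dderiv \<phi> (levi_civita g x u u) x"
  shows "cov_hessian g' \<phi> x u v = dderiv \<phi> (levi_civita g x u v) x"
proof -
  have xU: "x \<in> U" using x S by auto
  note lH = linear_add[OF cov_hessian_linear[OF g' S(1,3) \<phi> x]]
  note sH = cov_hessian_symm[OF g' S(1,3) \<phi> x]
  have lG: "levi_civita g x (a + b) c = levi_civita g x a c + levi_civita g x b c" for a b c
  proof -
    have "linear (\<lambda>a. levi_civita g x a c)"
      using smooth_metric.levi_civita_bilinear[OF g xU] by (simp add: bilinear_def)
    from linear_add[OF this] show ?thesis .
  qed
  note sG = smooth_metric.levi_civita_symm[OF g xU]
  note lD = linear_add[OF dderiv_linear[OF \<phi> x]]
  have "cov_hessian g' \<phi> x (u + v) (u + v)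
      = cov_hessian g' \<phi> x u u + cov_hessian g' \<phi> x v v + 2 *\<^sub>R cov_hessian g' \<phi> x u v"
    using sH[of u "u + v"] sH[of v "u + v"] sH[of v u] by (simp add: lH scaleR_2 ac_simps)
  moreover have "dderiv \<phi> (levi_civita g x (u + v) (u + v)) x
      = dderiv \<phi> (levi_civita g x u u) x + dderiv \<phi> (levi_civita g x v v) x
        + 2 *\<^sub>R dderiv \<phi> (levi_civita g x u v) x"
    using sG[of u "u + v"] sG[of v "u + v"] sG[of v u] by (simp add: lG lD scaleR_2 ac_simps)
  ultimately have "2 *\<^sub>R cov_hessian g' \<phi> x u v = 2 *\<^sub>R dderiv \<phi> (levi_civita g x u v) x"
    using diag[of "u + v"] diag[of u] diag[of v] by simp
  then show ?thesis by simp
qed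

text \<open>
  A local isometry preserves the connection: no nonzero vector is orthogonal to the image of its derivative. For changes
  of coordinates this is the transformation law of the Christoffel symbols.
\<close>

lemma isometry_cov_hessian_surj:
  fixes \<phi> :: "'n::euclidean_space \<Rightarrow> 'e::euclidean_space"
  assumes "smooth_metric U g" and "smooth_metric U' g'"
    and "open S" "S \<subseteq> U" "\<phi> ` S \<subseteq> U'" and "Ck_on (Suc (Suc 0)) S \<phi>"
    and "\<And>x u v. x \<in> S \<Longrightarrow> g' (\<phi> x) (dderiv \<phi> u x) (dderiv \<phi> v x) = g x u v"
    and "x \<in> S" and surj: "surj (\<lambda>u. dderiv \<phi> u x)"
  shows "cov_hessian g' \<phi> x u v = dderiv \<phi> (levi_civita g x u v) x"
proof (rule smooth_metric.metric_eqI[OF assms(2)])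
  show "\<phi> x \<in> U'" using assms by auto
  fix z obtain z' where z: "z = dderiv \<phi> z' x" using surjD[OF surj] by metis
  show "g' (\<phi> x) (cov_hessian g' \<phi> x u v) z = g' (\<phi> x) (dderiv \<phi> (levi_civita g x u v) x) z"
    unfolding z assms(7)[OF assms(8)]
    by (rule isometry_cov_hessian_tangential[OF assms(1-6) _ assms(8)]) (rule assms(7))
qed

section \<open>Charts and transition maps\<close>

text \<open>
  This covers both a submanifold of a manifold and a manifold in itself, so that the inclusion of a
  submanifold and changes of coordinates are treated by the same lemmas.
\<close>

definition smooth_inclusion :: "('a, 'n::euclidean_space) riem \<Rightarrow> ('a, 'e::euclidean_space) riem \<Rightarrow> bool"
  where "smooth_inclusion X Y \<longleftrightarrow> smooth_manifold X \<and> smooth_manifold Y \<and>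
    continuous_map (mtop X) (mtop Y) (\<lambda>p. p) \<and>
    (\<forall>c\<in>atlas X. \<forall>d\<in>atlas Y. smooth_map_on (transition_dom c d) (transition c d))"

lemma smooth_inclusion_refl: "smooth_manifold X \<Longrightarrow> smooth_inclusion X X"
  unfolding smooth_inclusion_def by (simp add: smooth_manifold_def)

lemma submanifold_imp_smooth_inclusion: "submanifold N M \<Longrightarrow> smooth_inclusion N M"
  by (simp add: smooth_inclusion_def submanifold_def)

lemma atlas_topological_chart: "smooth_manifold X \<Longrightarrow> c \<in> atlas X \<Longrightarrow> topological_chart (mtop X) c"
  by (simp add: smooth_manifold_def)

lemma inj_on_chart:
  assumes "smooth_manifold X" "c \<in> atlas X" shows "inj_on (snd c) (fst c)"
proof -
  note t = atlas_topological_chart[OF assms, unfolded topological_chart_def]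
  then have "fst c \<subseteq> topspace (mtop X)" by (meson openin_subset)
  then have "topspace (subtopology (mtop X) (fst c)) = fst c" by auto
  then show ?thesis using t homeomorphic_imp_injective_map by metis
qed

lemma transition_chart:
  "smooth_manifold X \<Longrightarrow> c \<in> atlas X \<Longrightarrow> p \<in> fst c \<Longrightarrow> transition c d (snd c p) = snd d p"
  by (simp add: transition_def inv_into_f_f[OF inj_on_chart])

lemma openin_chart: "smooth_manifold X \<Longrightarrow> c \<in> atlas X \<Longrightarrow> openin (mtop X) (fst c)"
  using atlas_topological_chart topological_chart_def by metis

lemma chart_image_open:
  assumes "smooth_manifold X" "c \<in> atlas X" "openin (mtop X) W" "W \<subseteq> fst c"
  shows "open (snd c ` W)"
proof -
  note t = atlas_topological_chart[OF assms(1,2), unfolded topological_chart_def]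
  have "openin (subtopology (mtop X) (fst c)) W"
    using assms(3,4) by (metis inf.orderE openin_subtopology)
  then have "openin (top_of_set (snd c ` fst c)) (snd c ` W)"
    using t homeomorphic_imp_open_map unfolding open_map_def by blast
  then show ?thesis using t openin_open_trans by blast
qed

lemma openin_chart_Int:
  assumes "smooth_inclusion X Y" "c \<in> atlas X" "d \<in> atlas Y"
  shows "openin (mtop X) (fst c \<inter> fst d)"
proof -
  have "openin (mtop X) {p \<in> topspace (mtop X). p \<in> fst d}"
    using assms unfolding smooth_inclusion_def by (auto intro!: openin_continuous_map_preimage openin_chart)
  moreover have c: "openin (mtop X) (fst c)"
    by (rule openin_chart[OF _ assms(2)]) (use assms(1) in \<open>simp add: smooth_inclusion_def\<close>)
  ultimately have "openin (mtop X) (fst c \<inter> {p \<in> topspace (mtop X). p \<in> fst d})" by blast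
  moreover have "fst c \<inter> {p \<in> topspace (mtop X). p \<in> fst d} = fst c \<inter> fst d"
    using openin_subset[OF c] by auto
  ultimately show ?thesis by simp
qed

lemma transition_dom_open:
  assumes "smooth_inclusion X Y" "c \<in> atlas X" "d \<in> atlas Y"
  shows "open (transition_dom c d)"
  unfolding transition_dom_def
  using chart_image_open[OF _ assms(2) openin_chart_Int[OF assms]] assms(1)
  by (simp add: smooth_inclusion_def)

lemma transition_dom_subset: "transition_dom c d \<subseteq> snd c ` fst c"
  by (auto simp: transition_dom_def)

lemma transition_image_subset:
  assumes "smooth_inclusion X Y" "c \<in> atlas X"
  shows "transition c d ` transition_dom c d \<subseteq> snd d ` fst d"
proof
  fix y assume "y \<in> transition c d ` transition_dom c d"
  then obtain p where p: "p \<in> fst c" "p \<in> fst d" "y = transition c d (snd c p)"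
    by (auto simp: transition_dom_def)
  have "smooth_manifold X" using assms(1) by (simp add: smooth_inclusion_def)
  then have "y = snd d p" using transition_chart[OF _ assms(2) p(1)] p(3) by metis
  then show "y \<in> snd d ` fst d" using p(2) by blast
qed

lemma transition_Ck:
  "smooth_inclusion X Y \<Longrightarrow> c \<in> atlas X \<Longrightarrow> d \<in> atlas Y \<Longrightarrow> Ck_on k (transition_dom c d) (transition c d)"
  by (simp add: smooth_inclusion_def smooth_map_on_def)

lemma chart_in_transition_dom: "p \<in> fst c \<Longrightarrow> p \<in> fst d \<Longrightarrow> snd c p \<in> transition_dom c d"
  by (auto simp: transition_dom_def)

lemma transition_has_derivative:
  assumes "smooth_inclusion X Y" "c \<in> atlas X" "d \<in> atlas Y" "p \<in> fst c" "p \<in> fst d"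
  shows "(transition c d has_derivative transition_deriv c d (snd c p)) (at (snd c p))"
  using Ck_on_has_derivative[OF transition_Ck[OF assms(1-3), of "Suc 0"] chart_in_transition_dom[OF assms(4,5)]]
  by (simp add: transition_deriv_def)

text \<open>
  The chain rule. With two of the three manifolds equal it says how the derivative of an inclusion
  changes with the charts.
\<close>

lemma transition_deriv_trans:
  fixes X :: "('a, 'n::euclidean_space) riem" and Y :: "('a, 'e::euclidean_space) riem"
    and Z :: "('a, 'f::euclidean_space) riem"
  assumes XY: "smooth_inclusion X Y" and YZ: "smooth_inclusion Y Z" and XZ: "smooth_inclusion X Z"
    and c: "c \<in> atlas X" and d: "d \<in> atlas Y" and e: "e \<in> atlas Z"
    and p: "p \<in> fst c" "p \<in> fst d" "p \<in> fst e"
  shows "transition_deriv c e (snd c p) u = transition_deriv d e (snd d p) (transition_deriv c d (snd c p) u)"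
proof -
  have X: "smooth_manifold X" and Y: "smooth_manifold Y" using XY by (auto simp: smooth_inclusion_def)
  have 1: "((\<lambda>x. transition d e (transition c d x)) has_derivative
     (\<lambda>u. transition_deriv d e (snd d p) (transition_deriv c d (snd c p) u))) (at (snd c p))"
    by (rule has_derivative_compose[OF transition_has_derivative[OF XY c d p(1,2)]])
       (simp add: transition_chart[OF X c p(1)] transition_has_derivative[OF YZ d e p(2,3)])
  let ?W = "(fst c \<inter> fst d) \<inter> (fst c \<inter> fst e)"
  have "openin (mtop X) ?W"
    by (rule openin_Int[OF openin_chart_Int[OF XY c d] openin_chart_Int[OF XZ c e]])
  then have W: "open (snd c ` ?W)" by (rule chart_image_open[OF X c]) auto
  have "(transition c e has_derivative
     (\<lambda>u. transition_deriv d e (snd d p) (transition_deriv c d (snd c p) u))) (at (snd c p))"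
    by (rule has_derivative_transform_within_open[OF 1 W])
       (use p in \<open>auto simp: transition_chart[OF X c] transition_chart[OF Y d]\<close>)
  from fun_cong[OF frechet_derivative_at[OF this]] show ?thesis
    unfolding transition_deriv_def[of c e] by (rule sym)
qed

lemma transition_deriv_self:
  assumes X: "smooth_manifold X" and c: "c \<in> atlas X" and p: "p \<in> fst c"
  shows "transition_deriv c c (snd c p) u = u"
proof -
  have "((\<lambda>x. x) has_derivative (\<lambda>u. u)) (at (snd c p))" by (rule has_derivative_ident)
  then have "(transition c c has_derivative (\<lambda>u. u)) (at (snd c p))"
    by (rule has_derivative_transform_within_open[OF _ chart_image_open[OF X c openin_chart[OF X c] subset_refl]])
       (use p in \<open>auto simp: transition_chart[OF X c]\<close>)
  from fun_cong[OF frechet_derivative_at[OF this]] show ?thesis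
    unfolding transition_deriv_def by (rule sym)
qed

lemma transition_deriv_surj:
  assumes X: "smooth_manifold X" and c: "c \<in> atlas X" and d: "d \<in> atlas X" and p: "p \<in> fst c" "p \<in> fst d"
  shows "surj (transition_deriv c d (snd c p))"
proof -
  note i = smooth_inclusion_refl[OF X]
  have "transition_deriv c d (snd c p) (transition_deriv d c (snd d p) w) = w" for w
    using transition_deriv_trans[OF i i i d c d p(2,1,2), of w] transition_deriv_self[OF X d p(2)] by simp
  then show ?thesis by (rule surjI)
qed

lemma riemannian_smooth_metric:
  assumes "riemannian_manifold X" "c \<in> atlas X"
  shows "smooth_metric (snd c ` fst c) (local_metric X c)"
proof
  have X: "smooth_manifold X" and g: "riemannian_metric X"
    using assms by (auto simp: riemannian_manifold_def)
  show "open (snd c ` fst c)"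
    by (rule chart_image_open[OF X assms(2) openin_chart[OF X assms(2)] subset_refl])
qed (use assms in \<open>auto simp: riemannian_manifold_def riemannian_metric_def\<close>)

lemma riemannian_transition_isometry:
  assumes "riemannian_manifold X" "c \<in> atlas X" "d \<in> atlas X" "x \<in> transition_dom c d"
  shows "local_metric X d (transition c d x) (transition_deriv c d x u) (transition_deriv c d x v)
     = local_metric X c x u v"
  using assms by (auto simp: riemannian_manifold_def riemannian_metric_def)

section \<open>Curves in charts\<close>

lemma nondegenerate_at_within_not_bot:
  assumes "nondegenerate_interval J" "s \<in> J" shows "at s within J \<noteq> bot"
proof -
  have "J \<noteq> {x}" for x using assms(1) by (auto simp: nondegenerate_interval_def)
  then have "s islimpt J"
    using assms by (intro connected_imp_perfect)
      (auto simp: nondegenerate_interval_def is_interval_connected_1)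
  then show ?thesis by (simp add: trivial_limit_within)
qed

lemma eventually_openin_along:
  assumes "continuous_map (top_of_set J) T \<gamma>" "s \<in> J" "openin T W" "\<gamma> s \<in> W"
  shows "eventually (\<lambda>r. r \<in> J \<and> \<gamma> r \<in> W) (at s within J)"
proof -
  have "openin (top_of_set J) {r \<in> J. \<gamma> r \<in> W}"
    using openin_continuous_map_preimage[OF assms(1,3)] by simp
  then obtain O' where "open O'" "{r \<in> J. \<gamma> r \<in> W} = J \<inter> O'" by (auto simp: openin_open)
  then show ?thesis using assms(2,4) unfolding eventually_at_topological by blast
qed

text \<open>
  The curve is known to be differentiable in the single chart \<open>c\<close>; its behaviour in all other charts, of
  \<open>X\<close> or of a manifold containing \<open>X\<close>, is derived from that.
\<close>

locale chart_curve =
  fixes X :: "('a, 'n::euclidean_space) riem" and c :: "('a, 'n) chart" and J :: "real set"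
    and \<gamma> :: "real \<Rightarrow> 'a" and v :: "real \<Rightarrow> 'n"
  assumes c: "c \<in> atlas X" and J: "nondegenerate_interval J"
    and cont: "continuous_map (top_of_set J) (mtop X) \<gamma>"
    and vel: "\<And>r. r \<in> J \<Longrightarrow> \<gamma> r \<in> fst c \<Longrightarrow> ((\<lambda>r. snd c (\<gamma> r)) has_vector_derivative v r) (at r within J)"
begin

context
  fixes Y :: "('a, 'e::euclidean_space) riem" and d :: "('a, 'e) chart"
  assumes XY: "smooth_inclusion X Y" and d: "d \<in> atlas Y"
begin

lemma X: "smooth_manifold X" using XY by (simp add: smooth_inclusion_def)

lemma chart_has_vector_derivative:
  assumes s: "s \<in> J" "\<gamma> s \<in> fst c" "\<gamma> s \<in> fst d"
  shows "((\<lambda>r. snd d (\<gamma> r)) has_vector_derivative transition_deriv c d (snd c (\<gamma> s)) (v s)) (at s within J)"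
proof -
  have "((\<lambda>r. transition c d (snd c (\<gamma> r))) has_vector_derivative
      dderiv (transition c d) (v s) (snd c (\<gamma> s))) (at s within J)"
    by (rule has_vector_derivative_compose_Ck[OF transition_Ck[OF XY c d]
        chart_in_transition_dom[OF s(2,3)] vel[OF s(1,2)]])
  then show ?thesis
    unfolding has_vector_derivative_def transition_deriv_def
    by (rule has_derivative_transform_eventually)
       (use eventually_openin_along[OF cont s(1) openin_chart[OF X c] s(2)] s
         in \<open>auto elim!: eventually_mono simp: transition_chart[OF X c]\<close>)
qed

lemma velocity_chart:
  assumes s: "s \<in> J" "\<gamma> s \<in> fst c" "\<gamma> s \<in> fst d"
  shows "velocity J \<gamma> s d = transition_deriv c d (snd c (\<gamma> s)) (v s)"
  unfolding velocity_def
  by (rule vector_derivative_within[OF nondegenerate_at_within_not_bot[OF J s(1)] chart_has_vector_derivative[OF s]])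

lemma velocity_has_vector_derivative:
  assumes s: "s \<in> J" "\<gamma> s \<in> fst c" "\<gamma> s \<in> fst d"
    and w: "(v has_vector_derivative w) (at s within J)"
  shows "((\<lambda>r. velocity J \<gamma> r d) has_vector_derivative
      dderiv (dderiv (transition c d) (v s)) (v s) (snd c (\<gamma> s)) + dderiv (transition c d) w (snd c (\<gamma> s)))
      (at s within J)"
proof -
  have "((\<lambda>r. dderiv (transition c d) (v r) (snd c (\<gamma> r))) has_vector_derivative
      dderiv (dderiv (transition c d) (v s)) (v s) (snd c (\<gamma> s)) + dderiv (transition c d) w (snd c (\<gamma> s)))
      (at s within J)"
    by (rule has_vector_derivative_dderiv_along[OF transition_Ck[OF XY c d] transition_dom_open[OF XY c d]
        chart_in_transition_dom[OF s(2,3)] s(1) vel[OF s(1,2)] w])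
  then show ?thesis
    unfolding has_vector_derivative_def
    by (rule has_derivative_transform_eventually)
       (use eventually_openin_along[OF cont s(1) openin_chart_Int[OF XY c d]] s
         in \<open>auto elim!: eventually_mono simp: velocity_chart transition_deriv_def\<close>)
qed

end

end

lemma C2_curve_chart_curve:
  assumes "C2_curve X I \<gamma>" "c \<in> atlas X"
  shows "chart_curve X c I \<gamma> (\<lambda>r. velocity I \<gamma> r c)"
proof
  fix r assume "r \<in> I" "\<gamma> r \<in> fst c"
  then have "(\<lambda>r. snd c (\<gamma> r)) differentiable (at r within I)"
    using assms by (auto simp: C2_curve_def)
  then show "((\<lambda>r. snd c (\<gamma> r)) has_vector_derivative velocity I \<gamma> r c) (at r within I)"
    unfolding velocity_def by (simp add: vector_derivative_works)
qed (use assms in \<open>auto simp: C2_curve_def\<close>)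

section \<open>Geodesics\<close>

lemma (in smooth_metric) continuous_on_levi_civita_along:
  assumes y: "continuous_on T y" "\<And>s. s \<in> T \<Longrightarrow> y s \<in> U" and V: "continuous_on T V" and W: "continuous_on T W"
  shows "continuous_on T (\<lambda>s. \<Gamma> (y s) (V s) (W s))"
proof -
  have "continuous_on T (\<lambda>s. \<Gamma> (y s) b b')" for b b'
    by (rule continuous_on_compose2[OF levi_civita_continuous y(1)]) (use y(2) in auto)
  then have "continuous_on T (\<lambda>s. \<Sum>b\<in>Basis. \<Sum>b'\<in>Basis. ((V s \<bullet> b) * (W s \<bullet> b')) *\<^sub>R \<Gamma> (y s) b b')"
    by (intro continuous_intros V W)
  then show ?thesis
    by (rule continuous_on_eq) (simp add: bilinear_expand[OF levi_civita_bilinear[OF y(2)]])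
qed

lemma (in smooth_metric) continuous_on_metric_along:
  assumes y: "continuous_on T y" "\<And>s. s \<in> T \<Longrightarrow> y s \<in> U" and V: "continuous_on T V" and W: "continuous_on T W"
  shows "continuous_on T (\<lambda>s. g (y s) (V s) (W s))"
proof -
  have "continuous_on T (\<lambda>s. g (y s) b b')" for b b'
    by (rule continuous_on_compose2[OF Ck_on_continuous[OF Ck_metric[of 0]] y(1)]) (use y(2) in auto)
  then have "continuous_on T (\<lambda>s. \<Sum>b\<in>Basis. \<Sum>b'\<in>Basis. ((V s \<bullet> b) * (W s \<bullet> b')) *\<^sub>R g (y s) b b')"
    by (intro continuous_intros V W)
  then show ?thesis
    by (rule continuous_on_eq) (simp add: bilinear_expand[OF bilin[OF y(2)]])
qed

text \<open>
  A solution of the geodesic equation in the chart \<open>c\<close> satisfies it in every chart \<open>d\<close>: its acceleration in \<open>d\<close> is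
  \<open>D\<^sup>2\<phi>(v, v) - D\<phi> (\<Gamma>\<^sub>c v v)\<close> for the change of coordinates \<open>\<phi>\<close>, which equals \<open>- \<Gamma>\<^sub>d(D\<phi> v, D\<phi> v)\<close> as \<open>\<phi>\<close> is a local
  isometry. The same formula gives continuity of the acceleration in \<open>d\<close>.
\<close>

lemma geodesic_through:
  fixes X :: "('a, 'n::euclidean_space) riem"
  assumes X: "riemannian_manifold X" and c: "c \<in> atlas X" and p: "p \<in> fst c"
  obtains J \<gamma> v where "geodesic X J \<gamma>" "chart_curve X c J \<gamma> v" "0 \<in> J" "\<gamma> 0 = p" "v 0 = u"
    "(v has_vector_derivative - christoffel X c (snd c p) u u) (at 0 within J)"
proof -
  have M: "smooth_manifold X" using X by (simp add: riemannian_manifold_def)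
  note i = smooth_inclusion_refl[OF M]
  interpret g: smooth_metric "snd c ` fst c" "local_metric X c" by (rule riemannian_smooth_metric[OF X c])
  have "snd c p \<in> snd c ` fst c" using p by simp
  then obtain h x v where h: "h > 0" "x 0 = snd c p" "v 0 = u"
    and xU: "\<And>t. t \<in> {0..h} \<Longrightarrow> x t \<in> snd c ` fst c"
    and x: "\<And>t. t \<in> {0..h} \<Longrightarrow> (x has_vector_derivative v t) (at t within {0..h})"
    and v: "\<And>t. t \<in> {0..h} \<Longrightarrow> (v has_vector_derivative - g.\<Gamma> (x t) (v t) (v t)) (at t within {0..h})"
    using g.geodesic_exists[of "snd c p" u] by metis
  define J where "J = {0..h}"
  have J: "nondegenerate_interval J"
    using h by (simp add: nondegenerate_interval_def J_def is_interval_cc)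
  note t = atlas_topological_chart[OF M c, unfolded topological_chart_def]
  then have top: "topspace (subtopology (mtop X) (fst c)) = fst c"
    by (meson openin_subset topspace_subtopology_subset)
  obtain q where q: "continuous_map (top_of_set (snd c ` fst c)) (subtopology (mtop X) (fst c)) q"
      "\<And>p. p \<in> fst c \<Longrightarrow> q (snd c p) = p" "\<And>y. y \<in> snd c ` fst c \<Longrightarrow> snd c (q y) = y"
    using t unfolding homeomorphic_map_maps homeomorphic_maps_def top by auto
  have q_in: "q y \<in> fst c" if "y \<in> snd c ` fst c" for y using that q(2) by auto
  define \<gamma> where "\<gamma> t = q (x t)" for t
  have \<gamma>c: "\<gamma> t \<in> fst c" and \<gamma>x: "snd c (\<gamma> t) = x t" if "t \<in> J" for t
    using that xU q_in q(3) by (auto simp: \<gamma>_def J_def)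
  have "continuous_on J x"
    unfolding J_def continuous_on_eq_continuous_within by (intro ballI has_vector_derivative_continuous[OF x])
  then have "continuous_map (top_of_set J) (top_of_set (snd c ` fst c)) x"
    using xU by (auto simp: continuous_map_in_subtopology J_def)
  from continuous_map_compose[OF this q(1)]
  have cont: "continuous_map (top_of_set J) (mtop X) \<gamma>"
    by (simp add: o_def \<gamma>_def[abs_def] continuous_map_in_subtopology)
  have xd: "((\<lambda>r. snd c (\<gamma> r)) has_vector_derivative v t) (at t within J)" if "t \<in> J" for t
    by (rule has_vector_derivative_transform[OF that \<gamma>x]) (use x that in \<open>auto simp: J_def\<close>)
  interpret cc: chart_curve X c J \<gamma> v
    by standard (use c J cont xd in auto)
  have vJ: "(v has_vector_derivative - christoffel X c (snd c (\<gamma> t)) (v t) (v t)) (at t within J)" if "t \<in> J" for t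
    using v[of t] that \<gamma>x[OF that] by (simp add: J_def christoffel_eq)
  have acc: "((\<lambda>r. velocity J \<gamma> r d) has_vector_derivative
      - christoffel X d (snd d (\<gamma> s)) (velocity J \<gamma> s d) (velocity J \<gamma> s d)) (at s within J)"
    if d: "d \<in> atlas X" and s: "s \<in> J" "\<gamma> s \<in> fst d" for d s
  proof -
    let ?\<phi> = "transition c d" and ?x = "snd c (\<gamma> s)"
    have dom: "?x \<in> transition_dom c d" by (rule chart_in_transition_dom[OF \<gamma>c[OF s(1)] s(2)])
    have hess: "cov_hessian (local_metric X d) ?\<phi> ?x (v s) (v s) = dderiv ?\<phi> (g.\<Gamma> ?x (v s) (v s)) ?x"
    proof (rule isometry_cov_hessian_surj[OF g.smooth_metric_axioms riemannian_smooth_metric[OF X d]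
          transition_dom_open[OF i c d] transition_dom_subset transition_image_subset[OF i c]
          transition_Ck[OF i c d] _ dom])
      show "surj (\<lambda>u. dderiv ?\<phi> u ?x)"
        using transition_deriv_surj[OF M c d \<gamma>c[OF s(1)] s(2)] by (simp add: transition_deriv_def)
    qed (use riemannian_transition_isometry[OF X c d] in \<open>simp add: transition_deriv_def\<close>)
    have \<phi>x: "?\<phi> ?x = snd d (\<gamma> s)" by (rule transition_chart[OF M c \<gamma>c[OF s(1)]])
    have vel: "velocity J \<gamma> s d = dderiv ?\<phi> (v s) ?x"
      by (simp only: cc.velocity_chart[OF i d s(1) \<gamma>c[OF s(1)] s(2)] transition_deriv_def)
    have neg: "dderiv ?\<phi> (- christoffel X c ?x (v s) (v s)) ?x = - dderiv ?\<phi> (g.\<Gamma> ?x (v s) (v s)) ?x"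
      unfolding christoffel_eq by (rule linear_neg[OF dderiv_linear[OF transition_Ck[OF i c d] dom]])
    have "dderiv (dderiv ?\<phi> (v s)) (v s) ?x + dderiv ?\<phi> (- christoffel X c ?x (v s) (v s)) ?x
      = - christoffel X d (snd d (\<gamma> s)) (velocity J \<gamma> s d) (velocity J \<gamma> s d)"
      unfolding neg unfolding hess[symmetric] cov_hessian_def \<phi>x vel christoffel_eq by simp
    then show ?thesis
      using cc.velocity_has_vector_derivative[OF i d s(1) \<gamma>c[OF s(1)] s(2) vJ[OF s(1)]] by simp
  qed
  have pos: "((\<lambda>r. snd d (\<gamma> r)) has_vector_derivative velocity J \<gamma> s d) (at s within J)"
    if d: "d \<in> atlas X" and s: "s \<in> J" "\<gamma> s \<in> fst d" for d s
    using cc.chart_has_vector_derivative[OF i d s(1) \<gamma>c[OF s(1)] s(2)]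
    by (simp add: cc.velocity_chart[OF i d s(1) \<gamma>c[OF s(1)] s(2)])
  have "C2_curve X J \<gamma>"
    unfolding C2_curve_def
  proof (intro conjI ballI impI J cont)
    fix d s assume d: "d \<in> atlas X" and s: "s \<in> J" "\<gamma> s \<in> fst d"
    show "(\<lambda>r. snd d (\<gamma> r)) differentiable (at s within J)"
      using pos[OF d s] by (rule differentiableI_vector)
    show "(\<lambda>r. velocity J \<gamma> r d) differentiable (at s within J)"
      using acc[OF d s] by (rule differentiableI_vector)
  next
    fix d assume d: "d \<in> atlas X"
    let ?T = "{s \<in> J. \<gamma> s \<in> fst d}"
    interpret gd: smooth_metric "snd d ` fst d" "local_metric X d" by (rule riemannian_smooth_metric[OF X d])
    have sub: "(f has_vector_derivative D) (at s within J) \<Longrightarrow> continuous (at s within ?T) f" for f :: "real \<Rightarrow> 'n" and D s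
      by (rule continuous_within_subset[OF has_vector_derivative_continuous]) auto
    have c1: "continuous_on ?T (\<lambda>s. snd d (\<gamma> s))" and c2: "continuous_on ?T (\<lambda>s. velocity J \<gamma> s d)"
      unfolding continuous_on_eq_continuous_within using sub[OF pos[OF d]] sub[OF acc[OF d]] by blast+
    have cont_\<Gamma>: "continuous_on ?T (\<lambda>s. - gd.\<Gamma> (snd d (\<gamma> s)) (velocity J \<gamma> s d) (velocity J \<gamma> s d))"
      by (rule continuous_on_minus[OF gd.continuous_on_levi_civita_along[OF c1 _ c2 c2]]) auto
    have vd: "vector_derivative (\<lambda>r. velocity J \<gamma> r d) (at s within J)
        = - gd.\<Gamma> (snd d (\<gamma> s)) (velocity J \<gamma> s d) (velocity J \<gamma> s d)" if "s \<in> ?T" for s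
    proof -
      have s: "s \<in> J" "\<gamma> s \<in> fst d" using that by auto
      show ?thesis
        using vector_derivative_within[OF nondegenerate_at_within_not_bot[OF J s(1)] acc[OF d s]]
        unfolding christoffel_eq .
    qed
    show "continuous_on ?T (\<lambda>s. vector_derivative (\<lambda>r. velocity J \<gamma> r d) (at s within J))"
      by (rule continuous_on_eq[OF cont_\<Gamma>]) (simp add: vd)
  qed
  moreover have "has_covariant_derivative X J \<gamma> (velocity J \<gamma>) (\<lambda>c. 0) s" if "s \<in> J" for s
    unfolding has_covariant_derivative_def
  proof (intro ballI impI exI conjI)
    fix d assume "d \<in> atlas X" "\<gamma> s \<in> fst d"
    from acc[OF this(1) that this(2)]
    show "((\<lambda>r. velocity J \<gamma> r d) has_vector_derivative
      - christoffel X d (snd d (\<gamma> s)) (velocity J \<gamma> s d) (velocity J \<gamma> s d)) (at s within J)" .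
  qed simp
  ultimately have geo: "geodesic X J \<gamma>" by (simp add: geodesic_def)
  have 0: "0 \<in> J" using h by (simp add: J_def)
  show ?thesis
  proof (rule that[OF geo cc.chart_curve_axioms 0])
    show p0: "\<gamma> 0 = p" using q(2)[OF p] h(2) by (simp add: \<gamma>_def)
    show "v 0 = u" by (rule h(3))
    then show "(v has_vector_derivative - christoffel X c (snd c p) u u) (at 0 within J)"
      using vJ[OF 0] p0 by simp
  qed
qed

text \<open>
  The second fundamental form of a totally geodesic submanifold vanishes. A geodesic of \<open>N\<close> with
  initial velocity \<open>u\<close> has vanishing covariant acceleration in \<open>N\<close> and in \<open>M\<close>; comparing the two at time \<open>0\<close> gives
  the claim for \<open>v = u\<close>, and polarization does the rest.
\<close>

lemma totally_geodesic_cov_hessian: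
  fixes N :: "('a, 'n::euclidean_space) riem" and M :: "('a, 'e::euclidean_space) riem"
  assumes tg: "totally_geodesic N M" and c: "c \<in> atlas N" and d: "d \<in> atlas M"
    and p: "p \<in> fst c" "p \<in> fst d"
  shows "cov_hessian (local_metric M d) (transition c d) (snd c p) u v
      = transition_deriv c d (snd c p) (christoffel N c (snd c p) u v)"
proof -
  have N: "riemannian_manifold N" and M: "riemannian_manifold M" and sub: "submanifold N M"
    using tg unfolding totally_geodesic_def riemannian_submanifold_def by blast+
  note i = submanifold_imp_smooth_inclusion[OF sub]
  have Nm: "smooth_manifold N" using N by (simp add: riemannian_manifold_def)
  let ?\<phi> = "transition c d" and ?x = "snd c p"
  have dom: "?x \<in> transition_dom c d" by (rule chart_in_transition_dom[OF p])
  have "cov_hessian (local_metric M d) ?\<phi> ?x u v = dderiv ?\<phi> (levi_civita (local_metric N c) ?x u v) ?x"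
  proof (rule cov_hessian_polarize[OF riemannian_smooth_metric[OF N c] riemannian_smooth_metric[OF M d]
        transition_dom_open[OF i c d] transition_dom_subset transition_image_subset[OF i c]
        transition_Ck[OF i c d] dom])
    fix u
    obtain J \<gamma> v where geo: "geodesic N J \<gamma>" and cc: "chart_curve N c J \<gamma> v" and 0: "0 \<in> J"
      and \<gamma>0: "\<gamma> 0 = p" and v0: "v 0 = u"
      and v: "(v has_vector_derivative - christoffel N c ?x u u) (at 0 within J)"
      using geodesic_through[OF N c p(1)] by metis
    have "geodesic M J \<gamma>" using tg geo by (simp add: totally_geodesic_def)
    then have "has_covariant_derivative M J \<gamma> (velocity J \<gamma>) (\<lambda>c. 0) 0" and J: "nondegenerate_interval J"
      using 0 by (auto simp: geodesic_def C2_curve_def)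
    then obtain D where D: "((\<lambda>r. velocity J \<gamma> r d) has_vector_derivative D) (at 0 within J)"
      and eq: "0 = D + christoffel M d (snd d p) (velocity J \<gamma> 0 d) (velocity J \<gamma> 0 d)"
      using d p \<gamma>0 unfolding has_covariant_derivative_def by metis
    have \<gamma>p: "\<gamma> 0 \<in> fst c" "\<gamma> 0 \<in> fst d" using p \<gamma>0 by auto
    have vel: "velocity J \<gamma> 0 d = dderiv ?\<phi> u ?x"
      using chart_curve.velocity_chart[OF cc i d 0 \<gamma>p] by (simp add: \<gamma>0 v0 transition_deriv_def)
    have "D = dderiv (dderiv ?\<phi> u) u ?x + dderiv ?\<phi> (- christoffel N c ?x u u) ?x"
      using vector_derivative_unique_within[OF nondegenerate_at_within_not_bot[OF J 0] D]
        chart_curve.velocity_has_vector_derivative[OF cc i d 0 \<gamma>p v] by (simp add: \<gamma>0 v0)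
    also have "\<dots> = dderiv (dderiv ?\<phi> u) u ?x - dderiv ?\<phi> (christoffel N c ?x u u) ?x"
      using linear_neg[OF dderiv_linear[OF transition_Ck[OF i c d] dom]] by simp
    finally have "dderiv (dderiv ?\<phi> u) u ?x = D + dderiv ?\<phi> (christoffel N c ?x u u) ?x" by simp
    then have "cov_hessian (local_metric M d) ?\<phi> ?x u u
        = (D + christoffel M d (snd d p) (velocity J \<gamma> 0 d) (velocity J \<gamma> 0 d)) + dderiv ?\<phi> (christoffel N c ?x u u) ?x"
      unfolding cov_hessian_def christoffel_eq vel transition_chart[OF Nm c p(1), of d] by simp
    then show "cov_hessian (local_metric M d) ?\<phi> ?x u u
        = dderiv ?\<phi> (levi_civita (local_metric N c) ?x u u) ?x"
      unfolding eq[symmetric] by (simp add: christoffel_eq)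
  qed
  then show ?thesis by (simp add: transition_deriv_def christoffel_eq)
qed

section \<open>The frame along a curve in a totally geodesic submanifold\<close>

text \<open>
  The map \<open>S\<close> of the introduction: the normal components, in the frame, of the vector tangent to the submanifold
  whose components in the chart \<open>c\<close> are \<open>u\<close>.
\<close>

definition frame_coords ::
  "('a, 'e::euclidean_space) riem \<Rightarrow> ('m::finite \<Rightarrow> real \<Rightarrow> ('a, 'e) tvec) \<Rightarrow> real \<Rightarrow> 'a \<Rightarrow>
   ('a, 'n::euclidean_space) chart \<Rightarrow> ('a, 'e) chart \<Rightarrow> 'n \<Rightarrow> real ^ 'm"
  where "frame_coords M nf s p c d u =
    (\<chi> i. local_metric M d (snd d p) (nf i s d) (transition_deriv c d (snd c p) u))"

locale frame_in_submanifold =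
  fixes M :: "('a, 'e::euclidean_space) riem" and N :: "('a, 'n::euclidean_space) riem"
    and I :: "real set" and \<alpha> :: "real \<Rightarrow> 'a" and nf :: "'m::finite \<Rightarrow> real \<Rightarrow> ('a, 'e) tvec"
    and \<kappa> :: "real \<Rightarrow> real ^ 'm"
  assumes tg: "totally_geodesic N M" and C2: "C2_curve N I \<alpha>"
    and rmf: "rotation_minimizing_frame M I \<alpha> nf \<kappa>"
begin

lemma riem_N: "riemannian_manifold N" and riem_M: "riemannian_manifold M" and sub: "submanifold N M"
  and induced: "has_induced_metric N M"
  using tg unfolding totally_geodesic_def riemannian_submanifold_def by blast+

lemma man_N: "smooth_manifold N" and man_M: "smooth_manifold M"
  using riem_N riem_M by (simp_all add: riemannian_manifold_def)

lemmas incl = submanifold_imp_smooth_inclusion[OF sub]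

lemma I: "nondegenerate_interval I" and cont_\<alpha>: "continuous_map (top_of_set I) (mtop N) \<alpha>"
  using C2 by (auto simp: C2_curve_def)

lemma ev_along:
  assumes "c \<in> atlas N" "d \<in> atlas M" "s \<in> I" "\<alpha> s \<in> fst c" "\<alpha> s \<in> fst d"
  shows "eventually (\<lambda>r. r \<in> I \<and> \<alpha> r \<in> fst c \<and> \<alpha> r \<in> fst d) (at s within I)"
  using eventually_openin_along[OF cont_\<alpha> assms(3) openin_chart_Int[OF incl assms(1,2)]] assms(4,5)
  by simp

lemma frame_tangent: "s \<in> I \<Longrightarrow> tangent_vector M (\<alpha> s) (nf i s)"
  and frame_unit: "s \<in> I \<Longrightarrow> has_inner M (\<alpha> s) (velocity I \<alpha> s) (velocity I \<alpha> s) 1"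
  and frame_normal: "s \<in> I \<Longrightarrow> has_inner M (\<alpha> s) (velocity I \<alpha> s) (nf i s) 0"
  and frame_rm: "s \<in> I \<Longrightarrow>
    has_covariant_derivative M I \<alpha> (nf i) (\<lambda>c. - (\<kappa> s $ i) *\<^sub>R velocity I \<alpha> s c) s"
  using rmf unfolding rotation_minimizing_frame_def by blast+

context
  fixes c :: "('a, 'n) chart" and d :: "('a, 'e) chart"
  assumes c: "c \<in> atlas N" and d: "d \<in> atlas M"
begin

abbreviation "x r \<equiv> snd c (\<alpha> r)"
abbreviation "y r \<equiv> snd d (\<alpha> r)"
abbreviation "x' r \<equiv> velocity I \<alpha> r c"
abbreviation "y' r \<equiv> velocity I \<alpha> r d"
abbreviation "x'' r \<equiv> vector_derivative (\<lambda>r. velocity I \<alpha> r c) (at r within I)"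
abbreviation "\<phi> \<equiv> transition c d"
abbreviation "S r \<equiv> frame_coords M nf r (\<alpha> r) c d"
\<comment> \<open>The covariant acceleration of \<open>\<alpha>\<close> in \<open>N\<close>.\<close>
abbreviation "w r \<equiv> x'' r + christoffel N c (x r) (x' r) (x' r)"
abbreviation "ode_coeff b k r \<equiv> christoffel N c (x r) (x' r) b \<bullet> k - local_metric N c (x r) (x' r) b * (w r \<bullet> k)"

interpretation gN: smooth_metric "snd c ` fst c" "local_metric N c"
  by (rule riemannian_smooth_metric[OF riem_N c])

interpretation gM: smooth_metric "snd d ` fst d" "local_metric M d"
  by (rule riemannian_smooth_metric[OF riem_M d])

interpretation cc: chart_curve N c I \<alpha> x'
  by (rule C2_curve_chart_curve[OF C2 c])

lemma x'_has_derivative: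
  assumes "s \<in> I" "\<alpha> s \<in> fst c"
  shows "(x' has_vector_derivative x'' s) (at s within I)"
  using C2 assms c unfolding C2_curve_def vector_derivative_works[symmetric] by blast

context
  fixes s assumes s: "s \<in> I" "\<alpha> s \<in> fst c" "\<alpha> s \<in> fst d"
begin

lemma dom: "x s \<in> transition_dom c d"
  by (rule chart_in_transition_dom[OF s(2,3)])

lemma yU: "y s \<in> snd d ` fst d" using s by simp

lemma trans: "\<phi> (x s) = y s"
  by (rule transition_chart[OF man_N c s(2)])

lemma y'_eq: "y' s = transition_deriv c d (x s) (x' s)"
  by (rule cc.velocity_chart[OF incl d s])

lemma y_has_derivative: "(y has_vector_derivative y' s) (at s within I)"
  unfolding y'_eq by (rule cc.chart_has_vector_derivative[OF incl d s])

lemma linear_transition_deriv: "linear (transition_deriv c d (x s))"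
  using dderiv_linear[OF transition_Ck[OF incl c d] dom] by (simp add: transition_deriv_def)

lemma linear_S: "linear (S s)"
proof (rule linearI)
  fix u v and r :: real
  note l = linear_add[OF gM.linear_right[OF yU]] linear_scale[OF gM.linear_right[OF yU]]
    linear_add[OF linear_transition_deriv] linear_scale[OF linear_transition_deriv]
  show "S s (u + v) = S s u + S s v" by (simp add: frame_coords_def vec_eq_iff l)
  show "S s (r *\<^sub>R u) = r *\<^sub>R S s u" by (simp add: frame_coords_def vec_eq_iff l)
qed

lemma induced_metric:
  "local_metric M d (y s) (transition_deriv c d (x s) u) (transition_deriv c d (x s) v) = local_metric N c (x s) u v"
  using induced c d dom unfolding has_induced_metric_def trans[symmetric] by simp

lemma S_velocity: "S s (x' s) = 0"
proof -
  have "local_metric M d (y s) (nf i s d) (y' s) = 0" for i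
    using frame_normal[OF s(1), of i] d s(3) gM.symm[OF yU, of "nf i s d" "y' s"] by (simp add: has_inner_def)
  then show ?thesis by (simp add: frame_coords_def vec_eq_iff y'_eq[symmetric])
qed

lemma velocity_nonzero: "x' s \<noteq> 0"
proof
  assume "x' s = 0"
  then have "y' s = 0" using linear_0[OF linear_transition_deriv] y'_eq by simp
  moreover have "local_metric M d (y s) (y' s) (y' s) = 1"
    using frame_unit[OF s(1)] d s(3) by (simp add: has_inner_def)
  ultimately show False using linear_0[OF gM.linear_left[OF yU]] by simp
qed

lemma hess: "cov_hessian (local_metric M d) \<phi> (x s) u v = transition_deriv c d (x s) (christoffel N c (x s) u v)"
  by (rule totally_geodesic_cov_hessian[OF tg c d s(2,3)])

lemma frame_derivative:
  obtains D where "((\<lambda>r. nf i r d) has_vector_derivative D) (at s within I)"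
    "D + gM.\<Gamma> (y s) (y' s) (nf i s d) = - (\<kappa> s $ i) *\<^sub>R y' s"
proof -
  obtain D where "((\<lambda>r. nf i r d) has_vector_derivative D) (at s within I)"
    "- (\<kappa> s $ i) *\<^sub>R y' s = D + gM.\<Gamma> (y s) (y' s) (nf i s d)"
    using frame_rm[OF s(1), of i] d s(3) unfolding has_covariant_derivative_def christoffel_eq by blast
  then show ?thesis using that by metis
qed

text \<open>
  Differentiating \<open>\<langle>t, n\<^sub>i\<rangle> = 0\<close> gives \<open>\<langle>\<nabla>\<^sub>t t, n\<^sub>i\<rangle> = \<kappa>\<^sub>i\<close>, since \<open>\<nabla>\<^sub>t n\<^sub>i = - \<kappa>\<^sub>i t\<close> and \<open>|t| = 1\<close>; and \<open>\<nabla>\<^sub>t t\<close> is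
  the image of the acceleration in \<open>N\<close>, as the second fundamental form vanishes.
\<close>

lemma normal_development_eq: "\<kappa> s = S s (w s)"
proof -
  have "\<kappa> s $ i = S s (w s) $ i" for i
  proof -
    obtain D where D: "((\<lambda>r. nf i r d) has_vector_derivative D) (at s within I)"
      "D + gM.\<Gamma> (y s) (y' s) (nf i s d) = - (\<kappa> s $ i) *\<^sub>R y' s"
      by (rule frame_derivative)
    have V: "(y' has_vector_derivative
        dderiv (dderiv \<phi> (x' s)) (x' s) (x s) + dderiv \<phi> (x'' s) (x s)) (at s within I)"
      by (rule cc.velocity_has_vector_derivative[OF incl d s x'_has_derivative[OF s(1,2)]])
    have acc: "(dderiv (dderiv \<phi> (x' s)) (x' s) (x s) + dderiv \<phi> (x'' s) (x s)) + gM.\<Gamma> (y s) (y' s) (y' s)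
        = transition_deriv c d (x s) (w s)"
      using hess[of "x' s" "x' s"] unfolding cov_hessian_def trans linear_add[OF linear_transition_deriv] y'_eq
      by (simp add: transition_deriv_def)
    have "((\<lambda>r. local_metric M d (y r) (y' r) (nf i r d)) has_real_derivative
        local_metric M d (y s) (transition_deriv c d (x s) (w s)) (nf i s d)
        + local_metric M d (y s) (y' s) (- (\<kappa> s $ i) *\<^sub>R y' s)) (at s within I)"
      using gM.has_derivative_metric_along[OF yU y_has_derivative V D(1) s(1)] unfolding acc D(2) .
    moreover have "((\<lambda>r. local_metric M d (y r) (y' r) (nf i r d)) has_real_derivative 0) (at s within I)"
    proof -
      have z: "local_metric M d (y r) (y' r) (nf i r d) = 0" if "r \<in> I" "\<alpha> r \<in> fst d" for r
        using frame_normal[OF that(1), of i] d that(2) by (simp add: has_inner_def)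
      have "((\<lambda>r. 0::real) has_derivative (\<lambda>h. 0)) (at s within I)" by simp
      then have "((\<lambda>r. local_metric M d (y r) (y' r) (nf i r d)) has_derivative (\<lambda>h. 0)) (at s within I)"
        by (rule has_derivative_transform_eventually)
           (use ev_along[OF c d s] z s in \<open>auto elim!: eventually_mono\<close>)
      then show ?thesis by (simp add: has_field_derivative_def lambda_zero)
    qed
    ultimately have "local_metric M d (y s) (transition_deriv c d (x s) (w s)) (nf i s d)
        + local_metric M d (y s) (y' s) (- (\<kappa> s $ i) *\<^sub>R y' s) = 0"
      using vector_derivative_unique_within[OF nondegenerate_at_within_not_bot[OF I s(1)]]
      unfolding has_real_derivative_iff_has_vector_derivative by blast
    moreover have "local_metric M d (y s) (y' s) (y' s) = 1"
      using frame_unit[OF s(1)] d s(3) by (simp add: has_inner_def)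
    then have "local_metric M d (y s) (y' s) (- (\<kappa> s $ i) *\<^sub>R y' s) = - (\<kappa> s $ i)"
      by (simp only: linear_scale[OF gM.linear_right[OF yU]]) simp
    ultimately show ?thesis
      using gM.symm[OF yU, of "transition_deriv c d (x s) (w s)"] by (simp add: frame_coords_def)
  qed
  then show ?thesis by (simp add: vec_eq_iff)
qed

text \<open>
  The product rule for \<open>\<langle>n\<^sub>i, D\<phi> u\<rangle>\<close>, with \<open>\<nabla>\<^sub>t n\<^sub>i = - \<kappa>\<^sub>i t\<close> and with \<open>\<nabla>\<^sub>t (D\<phi> u)\<close> tangent to \<open>N\<close>.
\<close>

lemma S_has_derivative:
  "((\<lambda>r. a \<bullet> S r u) has_real_derivative
     a \<bullet> S s (christoffel N c (x s) (x' s) u) - local_metric N c (x s) (x' s) u * (a \<bullet> \<kappa> s)) (at s within I)"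
proof -
  have W: "((\<lambda>r. transition_deriv c d (x r) u) has_vector_derivative dderiv (dderiv \<phi> u) (x' s) (x s)) (at s within I)"
    unfolding transition_deriv_def
    by (rule has_vector_derivative_compose_Ck[OF Ck_on_dderiv[OF transition_Ck[OF incl c d]] dom cc.vel[OF s(1,2)]])
  have W': "dderiv (dderiv \<phi> u) (x' s) (x s) + gM.\<Gamma> (y s) (y' s) (transition_deriv c d (x s) u)
      = transition_deriv c d (x s) (christoffel N c (x s) (x' s) u)"
    unfolding hess[symmetric] cov_hessian_def trans y'_eq by (simp add: transition_deriv_def)
  have comp: "((\<lambda>r. S r u $ i) has_real_derivative
      S s (christoffel N c (x s) (x' s) u) $ i - local_metric N c (x s) (x' s) u * \<kappa> s $ i) (at s within I)" for i
  proof -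
    obtain D where D: "((\<lambda>r. nf i r d) has_vector_derivative D) (at s within I)"
      "D + gM.\<Gamma> (y s) (y' s) (nf i s d) = - (\<kappa> s $ i) *\<^sub>R y' s"
      by (rule frame_derivative)
    have "((\<lambda>r. local_metric M d (y r) (nf i r d) (transition_deriv c d (x r) u)) has_real_derivative
        local_metric M d (y s) (- (\<kappa> s $ i) *\<^sub>R y' s) (transition_deriv c d (x s) u)
        + local_metric M d (y s) (nf i s d) (transition_deriv c d (x s) (christoffel N c (x s) (x' s) u))) (at s within I)"
      using gM.has_derivative_metric_along[OF yU y_has_derivative D(1) W s(1)] unfolding W' D(2) .
    moreover have "local_metric M d (y s) (- (\<kappa> s $ i) *\<^sub>R y' s) (transition_deriv c d (x s) u)
        = - (\<kappa> s $ i) * local_metric N c (x s) (x' s) u"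
      by (simp only: linear_scale[OF gM.linear_left[OF yU]] y'_eq induced_metric) simp
    ultimately show ?thesis by (simp add: frame_coords_def mult.commute)
  qed
  have "((\<lambda>r. \<Sum>i\<in>UNIV. a $ i * S r u $ i) has_real_derivative
     (\<Sum>i\<in>UNIV. a $ i * (S s (christoffel N c (x s) (x' s) u) $ i - local_metric N c (x s) (x' s) u * \<kappa> s $ i))) (at s within I)"
    by (intro DERIV_sum DERIV_cmult comp)
  then show ?thesis
    by (simp add: inner_vec_def right_diff_distrib sum_subtractf sum_distrib_left mult.left_commute)
qed

text \<open>
  The inhomogeneous term \<open>a \<bullet> \<kappa>\<close> is itself linear in \<open>a \<bullet> S\<close>, because \<open>\<kappa> = S w\<close>. Hence the functions \<open>a \<bullet> S b\<close>, with
  \<open>b\<close> in a basis, satisfy a homogeneous linear system with coefficients independent of \<open>a\<close>.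
\<close>

lemma S_has_derivative_linear:
  "((\<lambda>r. a \<bullet> S r b) has_real_derivative (\<Sum>k\<in>Basis. ode_coeff b k s * (a \<bullet> S s k))) (at s within I)"
proof -
  have lin: "linear (\<lambda>u. a \<bullet> S s u)"
    using linear_compose[OF linear_S bounded_linear.linear[OF bounded_linear_inner_right[of a]]]
    by (simp add: o_def)
  have ex: "a \<bullet> S s u = (\<Sum>k\<in>Basis. (u \<bullet> k) * (a \<bullet> S s k))" for u
    using linear_expand[OF lin, of u] unfolding real_scaleR_def .
  have "a \<bullet> S s (christoffel N c (x s) (x' s) b) - local_metric N c (x s) (x' s) b * (a \<bullet> \<kappa> s)
      = (\<Sum>k\<in>Basis. ode_coeff b k s * (a \<bullet> S s k))"
    unfolding normal_development_eq ex[of "christoffel N c (x s) (x' s) b"] ex[of "w s"]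
    by (simp add: sum_distrib_left sum_subtractf[symmetric] left_diff_distrib mult.assoc)
  then show ?thesis using S_has_derivative[of a b] by simp
qed

end

lemma ode_coeff_continuous:
  assumes s: "s \<in> I" "\<alpha> s \<in> fst c"
  shows "continuous (at s within I) (ode_coeff b k)"
proof -
  let ?T = "{s \<in> I. \<alpha> s \<in> fst c}"
  have sub: "continuous (at s within I) f \<Longrightarrow> continuous (at s within ?T) f" for f :: "real \<Rightarrow> 'n" and s
    by (rule continuous_within_subset) auto
  have c1: "continuous_on ?T x" and c2: "continuous_on ?T x'"
    unfolding continuous_on_eq_continuous_within
    using sub[OF has_vector_derivative_continuous[OF cc.vel]]
      sub[OF has_vector_derivative_continuous[OF x'_has_derivative]] by blast+
  have c3: "continuous_on ?T x''" using C2 c unfolding C2_curve_def by blast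
  have cG: "continuous_on ?T (\<lambda>r. christoffel N c (x r) (f r) (h r))"
    if "continuous_on ?T f" "continuous_on ?T h" for f h
    unfolding christoffel_eq by (rule gN.continuous_on_levi_civita_along[OF c1 _ that]) auto
  have cg: "continuous_on ?T (\<lambda>r. local_metric N c (x r) (x' r) b)"
    by (rule gN.continuous_on_metric_along[OF c1 _ c2 continuous_on_const]) auto
  have "continuous_on ?T (ode_coeff b k)"
    by (intro continuous_intros cG cg c2 c3)
  then have "continuous (at s within ?T) (ode_coeff b k)"
    using s by (simp add: continuous_on_eq_continuous_within)
  moreover have "at s within ?T = at s within I"
  proof -
    have "openin (top_of_set I) ?T"
      using openin_continuous_map_preimage[OF cont_\<alpha> openin_chart[OF man_N c]] by simp
    then obtain O' where O': "open O'" "?T = I \<inter> O'" by (auto simp: openin_open)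
    show ?thesis by (rule at_within_nhd[of s O']) (use O' s in auto)
  qed
  ultimately show ?thesis by simp
qed

text \<open>
  Gronwall's lemma for the sum of the squares of the functions \<open>a \<bullet> S b\<close>, which solve a linear system with
  bounded coefficients: if they vanish at one point, they vanish at all points nearby.
\<close>

lemma normal_space_locally_constant:
  assumes s0: "s0 \<in> I" "\<alpha> s0 \<in> fst c" "\<alpha> s0 \<in> fst d"
  obtains \<delta> where "\<delta> > 0" "\<And>s. s \<in> I \<inter> ball s0 \<delta> \<Longrightarrow> \<alpha> s \<in> fst c \<and> \<alpha> s \<in> fst d"
    "\<And>a s1 s2 u. s1 \<in> I \<inter> ball s0 \<delta> \<Longrightarrow> s2 \<in> I \<inter> ball s0 \<delta> \<Longrightarrow> (\<And>u. a \<bullet> S s1 u = 0) \<Longrightarrow> a \<bullet> S s2 u = 0"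
proof -
  have "eventually (\<lambda>r. \<bar>ode_coeff b k r\<bar> < \<bar>ode_coeff b k s0\<bar> + 1) (at s0 within I)" for b k
    by (rule order_tendstoD(2)[OF tendsto_rabs[OF ode_coeff_continuous[OF s0(1,2), unfolded continuous_within]]]) simp
  then have "eventually (\<lambda>r. (\<forall>b\<in>Basis. \<forall>k\<in>Basis. \<bar>ode_coeff b k r\<bar> < \<bar>ode_coeff b k s0\<bar> + 1)
      \<and> r \<in> I \<and> \<alpha> r \<in> fst c \<and> \<alpha> r \<in> fst d) (at s0 within I)"
    by (intro eventually_conj ev_along[OF c d s0] eventually_ball_finite ballI) auto
  then obtain \<delta> where \<delta>: "\<delta> > 0" and near: "\<And>r. r \<in> I \<Longrightarrow> r \<noteq> s0 \<Longrightarrow> dist r s0 < \<delta> \<Longrightarrow>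
     (\<forall>b\<in>Basis. \<forall>k\<in>Basis. \<bar>ode_coeff b k r\<bar> < \<bar>ode_coeff b k s0\<bar> + 1) \<and> \<alpha> r \<in> fst c \<and> \<alpha> r \<in> fst d"
    unfolding eventually_at by blast
  define K where "K = I \<inter> ball s0 \<delta>"
  have in_charts: "\<alpha> r \<in> fst c" "\<alpha> r \<in> fst d" if "r \<in> K" for r
    using near[of r] s0 that by (cases "r = s0"; auto simp: K_def dist_commute)+
  define C where "C = (\<Sum>b\<in>Basis. \<Sum>k\<in>Basis. \<bar>ode_coeff b k s0\<bar> + 1)"
  have ode_coeff_le: "\<bar>ode_coeff b k r\<bar> \<le> C" if "r \<in> K" "b \<in> Basis" "k \<in> Basis" for b k r
  proof -
    have "\<bar>ode_coeff b k r\<bar> \<le> \<bar>ode_coeff b k s0\<bar> + 1"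
      using near[of r] that by (cases "r = s0") (auto simp: K_def dist_commute less_imp_le)
    also have "\<dots> \<le> (\<Sum>k\<in>Basis. \<bar>ode_coeff b k s0\<bar> + 1)"
      using that by (intro member_le_sum[of k Basis "\<lambda>k. \<bar>ode_coeff b k s0\<bar> + 1"]) auto
    also have "\<dots> \<le> C" unfolding C_def
      using that by (intro member_le_sum[of b Basis "\<lambda>b. \<Sum>k\<in>Basis. \<bar>ode_coeff b k s0\<bar> + 1"] sum_nonneg) auto
    finally show ?thesis .
  qed
  have K: "is_interval K"
    using I unfolding K_def nondegenerate_interval_def by (intro is_interval_Int) (auto simp: is_interval_ball_real)
  have "a \<bullet> S s2 u = 0" if s1: "s1 \<in> K" and s2: "s2 \<in> K" and a: "\<And>u. a \<bullet> S s1 u = 0" for a s1 s2 u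
  proof -
    define f where "f b r = a \<bullet> S r b" for b r
    define h where "h r = (\<Sum>b\<in>Basis. (f b r)\<^sup>2)" for r
    define h' where "h' r = (\<Sum>b\<in>Basis. \<Sum>k\<in>Basis. 2 * f b r * (ode_coeff b k r * f k r))" for r
    have "h s2 = 0"
    proof (rule gronwall_zero[OF K s1 s2, where h' = h' and C = "2 * C * real DIM('n)"])
      show "h s1 = 0" by (simp add: h_def f_def a)
      show "h s2 \<ge> 0" by (simp add: h_def sum_nonneg)
    next
      fix t assume t: "t \<in> K"
      then have tI: "t \<in> I" by (simp add: K_def)
      have "(f b has_real_derivative (\<Sum>k\<in>Basis. ode_coeff b k t * f k t)) (at t within I)" for b
        using S_has_derivative_linear[OF tI in_charts[OF t], of a b] by (simp add: f_def[abs_def])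
      then have "((\<lambda>r. (f b r)\<^sup>2) has_real_derivative 2 * f b t * (\<Sum>k\<in>Basis. ode_coeff b k t * f k t)) (at t within I)" for b
        by (auto intro!: derivative_eq_intros)
      then have "(h has_real_derivative h' t) (at t within I)"
        unfolding h_def[abs_def] h'_def sum_distrib_left[symmetric] by (intro DERIV_sum)
      then show "(h has_real_derivative h' t) (at t within K)"
        by (rule DERIV_subset) (simp add: K_def)
      have "\<bar>2 * f b t * (ode_coeff b k t * f k t)\<bar> \<le> C * ((f b t)\<^sup>2 + (f k t)\<^sup>2)" if "b \<in> Basis" "k \<in> Basis" for b k
      proof -
        have "2 * (\<bar>f b t\<bar> * \<bar>f k t\<bar>) \<le> (f b t)\<^sup>2 + (f k t)\<^sup>2"
          using sum_squares_bound[of "\<bar>f b t\<bar>" "\<bar>f k t\<bar>"] by (simp add: mult.assoc)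
        moreover have "\<bar>ode_coeff b k t\<bar> \<le> C" by (rule ode_coeff_le[OF t that])
        ultimately have "\<bar>ode_coeff b k t\<bar> * (2 * (\<bar>f b t\<bar> * \<bar>f k t\<bar>)) \<le> C * ((f b t)\<^sup>2 + (f k t)\<^sup>2)"
          by (intro mult_mono) auto
        then show ?thesis by (simp add: abs_mult ac_simps)
      qed
      then have "\<bar>h' t\<bar> \<le> (\<Sum>b\<in>Basis. \<Sum>k\<in>Basis. C * ((f b t)\<^sup>2 + (f k t)\<^sup>2))"
        unfolding h'_def by (intro order_trans[OF sum_abs sum_mono]) auto
      also have "\<dots> = 2 * C * real DIM('n) * h t"
        by (simp add: h_def sum.distrib distrib_left sum_distrib_left[symmetric])
      finally show "\<bar>h' t\<bar> \<le> 2 * C * real DIM('n) * h t" .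
    qed
    then have "f b s2 = 0" if "b \<in> Basis" for b
      using that by (simp add: h_def sum_nonneg_eq_0_iff)
    moreover have "S s2 u = (\<Sum>b\<in>Basis. (u \<bullet> b) *\<^sub>R S s2 b)"
      by (rule linear_expand[OF linear_S]) (use s2 in_charts in \<open>auto simp: K_def\<close>)
    ultimately show ?thesis by (simp add: f_def inner_sum_right)
  qed
  then show ?thesis using that[OF \<delta>] in_charts unfolding K_def by blast
qed

end

lemma frame_coords_change_charts:
  assumes c: "c \<in> atlas N" "c1 \<in> atlas N" and d: "d \<in> atlas M" "d1 \<in> atlas M" and s: "s \<in> I"
    and mem: "\<alpha> s \<in> fst c" "\<alpha> s \<in> fst c1" "\<alpha> s \<in> fst d" "\<alpha> s \<in> fst d1"
  shows "frame_coords M nf s (\<alpha> s) c1 d1 u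
    = frame_coords M nf s (\<alpha> s) c d (transition_deriv c1 c (snd c1 (\<alpha> s)) u)"
proof -
  note iN = smooth_inclusion_refl[OF man_N] and iM = smooth_inclusion_refl[OF man_M]
  let ?p = "\<alpha> s"
  have 1: "transition_deriv c1 d1 (snd c1 ?p) u
    = transition_deriv d d1 (snd d ?p) (transition_deriv c d (snd c ?p) (transition_deriv c1 c (snd c1 ?p) u))"
    unfolding transition_deriv_trans[OF incl iM incl c(2) d mem(2,3,4)]
      transition_deriv_trans[OF iN incl incl c(2) c(1) d(1) mem(2,1,3)] ..
  have 2: "nf i s d1 = transition_deriv d d1 (snd d ?p) (nf i s d)" for i
    using frame_tangent[OF s, of i] d mem unfolding tangent_vector_def by blast
  show ?thesis
    unfolding frame_coords_def 1 2
    using riemannian_transition_isometry[OF riem_M d chart_in_transition_dom[OF mem(3,4)]]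
    by (simp add: transition_chart[OF man_M d(1) mem(3)])
qed

text \<open>
  The orthogonal complement of the range of \<open>S\<close>, in a form that is visibly independent of charts; this is
  needed to compare points of the curve that no single chart contains.
\<close>

definition normal_coeffs :: "real \<Rightarrow> (real ^ 'm) set"
  where "normal_coeffs s = {a. \<forall>c\<in>atlas N. \<forall>d\<in>atlas M. \<alpha> s \<in> fst c \<longrightarrow> \<alpha> s \<in> fst d \<longrightarrow>
    (\<forall>u. a \<bullet> frame_coords M nf s (\<alpha> s) c d u = 0)}"

lemma normal_coeffs_chart:
  assumes "c \<in> atlas N" "d \<in> atlas M" "s \<in> I" "\<alpha> s \<in> fst c" "\<alpha> s \<in> fst d"
  shows "normal_coeffs s = {a. \<forall>u. a \<bullet> frame_coords M nf s (\<alpha> s) c d u = 0}"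
proof (intro equalityI subsetI CollectI allI)
  show "a \<bullet> frame_coords M nf s (\<alpha> s) c d u = 0" if "a \<in> normal_coeffs s" for a u
    using that assms unfolding normal_coeffs_def by blast
  show "a \<in> normal_coeffs s" if "a \<in> {a. \<forall>u. a \<bullet> frame_coords M nf s (\<alpha> s) c d u = 0}" for a
    unfolding normal_coeffs_def
  proof (intro CollectI ballI impI allI)
    fix c1 d1 u assume "c1 \<in> atlas N" "d1 \<in> atlas M" "\<alpha> s \<in> fst c1" "\<alpha> s \<in> fst d1"
    from frame_coords_change_charts[OF assms(1) this(1) assms(2) this(2) assms(3,4) this(3) assms(5) this(4)] that
    show "a \<bullet> frame_coords M nf s (\<alpha> s) c1 d1 u = 0" by simp
  qed
qed

lemma charts_around:
  assumes "s \<in> I"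
  obtains c d where "c \<in> atlas N" "d \<in> atlas M" "\<alpha> s \<in> fst c" "\<alpha> s \<in> fst d"
proof -
  have N: "\<alpha> s \<in> topspace (mtop N)"
    using cont_\<alpha> assms by (auto simp: continuous_map_def)
  then have "\<alpha> s \<in> topspace (mtop M)" using sub by (auto simp: submanifold_def)
  then show ?thesis using N man_N man_M that unfolding smooth_manifold_def by blast
qed

lemma normal_coeffs_constant:
  assumes "s \<in> I" "t \<in> I"
  shows "normal_coeffs s = normal_coeffs t"
proof (rule connected_local_const[OF _ assms])
  show "connected I" using I by (simp add: nondegenerate_interval_def is_interval_connected_1)
  show "\<forall>s\<in>I. eventually (\<lambda>r. normal_coeffs s = normal_coeffs r) (at s within I)"
  proof
    fix s assume s: "s \<in> I"
    obtain c d where c: "c \<in> atlas N" and d: "d \<in> atlas M" and m: "\<alpha> s \<in> fst c" "\<alpha> s \<in> fst d"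
      using charts_around[OF s] by blast
    obtain \<delta> where \<delta>: "\<delta> > 0" "\<And>s'. s' \<in> I \<inter> ball s \<delta> \<Longrightarrow> \<alpha> s' \<in> fst c \<and> \<alpha> s' \<in> fst d"
      and const: "\<And>a s1 s2 u. s1 \<in> I \<inter> ball s \<delta> \<Longrightarrow> s2 \<in> I \<inter> ball s \<delta> \<Longrightarrow>
        (\<And>u. a \<bullet> frame_coords M nf s1 (\<alpha> s1) c d u = 0) \<Longrightarrow> a \<bullet> frame_coords M nf s2 (\<alpha> s2) c d u = 0"
      using normal_space_locally_constant[OF c d s m] by metis
    have "normal_coeffs s = normal_coeffs r" if r: "r \<in> I" "dist r s < \<delta>" for r
    proof -
      have rs: "r \<in> I \<inter> ball s \<delta>" "s \<in> I \<inter> ball s \<delta>" using r s \<delta>(1) by (auto simp: dist_commute)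
      show ?thesis
        unfolding normal_coeffs_chart[OF c d s m] normal_coeffs_chart[OF c d r(1) conjunct1[OF \<delta>(2)[OF rs(1)]] conjunct2[OF \<delta>(2)[OF rs(1)]]]
        using const[OF rs(2,1)] const[OF rs(1,2)] by blast
    qed
    then show "eventually (\<lambda>r. normal_coeffs s = normal_coeffs r) (at s within I)"
      unfolding eventually_at using \<delta>(1) by blast
  qed
qed

text \<open>
  The subspace is the range of \<open>S\<close> at one point. It loses a dimension because \<open>S\<close> kills the velocity.
\<close>

lemma normal_development_in_subspace:
  obtains B :: "(real ^ 'm) set" where "subspace B" "dim B \<le> DIM('n) - 1" "\<And>s. s \<in> I \<Longrightarrow> \<kappa> s \<in> B"
proof -
  have "I \<noteq> {}" using I by (auto simp: nondegenerate_interval_def)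
  then obtain s0 where s0: "s0 \<in> I" by blast
  obtain c d where c: "c \<in> atlas N" and d: "d \<in> atlas M" and m: "\<alpha> s0 \<in> fst c" "\<alpha> s0 \<in> fst d"
    using charts_around[OF s0] by blast
  let ?S = "frame_coords M nf s0 (\<alpha> s0) c d" and ?v = "velocity I \<alpha> s0 c"
  define B where "B = range ?S"
  have lin: "linear ?S" by (rule linear_S[OF c d s0 m])
  have v: "?v \<noteq> 0" "?S ?v = 0" by (rule velocity_nonzero[OF c d s0 m], rule S_velocity[OF c d s0 m])
  have B: "subspace B" unfolding B_def by (rule linear_subspace_image[OF lin subspace_UNIV])
  have "B = ?S ` {u. ?v \<bullet> u = 0}"
  proof -
    have "?S u \<in> ?S ` {u. ?v \<bullet> u = 0}" for u
    proof (rule image_eqI)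
      let ?u = "u - ((?v \<bullet> u) / (?v \<bullet> ?v)) *\<^sub>R ?v"
      show "?S u = ?S ?u" using v(2) by (simp add: linear_diff[OF lin] linear_scale[OF lin])
      show "?u \<in> {u. ?v \<bullet> u = 0}" using v(1) by (simp add: inner_diff_right)
    qed
    then show ?thesis unfolding B_def by blast
  qed
  then have "dim B \<le> dim {u. ?v \<bullet> u = 0}" using dim_image_le[OF lin] by simp
  also have "\<dots> = DIM('n) - 1" by (rule dim_hyperplane[OF v(1)])
  finally have dB: "dim B \<le> DIM('n) - 1" .
  have "\<kappa> s \<in> B" if s: "s \<in> I" for s
  proof -
    obtain c1 d1 where c1: "c1 \<in> atlas N" and d1: "d1 \<in> atlas M" and m1: "\<alpha> s \<in> fst c1" "\<alpha> s \<in> fst d1"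
      using charts_around[OF s] by blast
    have "a \<bullet> \<kappa> s = 0" if a: "a \<in> orthogonal_comp B" for a
    proof -
      have "a \<in> normal_coeffs s0"
        using a unfolding normal_coeffs_chart[OF c d s0 m] B_def orthogonal_comp_def
        by (auto simp: orthogonal_def inner_commute)
      then have "a \<in> normal_coeffs s" using normal_coeffs_constant[OF s0 s] by simp
      then show ?thesis
        unfolding normal_development_eq[OF c1 d1 s m1] normal_coeffs_chart[OF c1 d1 s m1] by blast
    qed
    then have "\<kappa> s \<in> orthogonal_comp (orthogonal_comp B)"
      unfolding orthogonal_comp_def[of "orthogonal_comp B"] by (simp add: orthogonal_def)
    then show ?thesis using orthogonal_comp_self[OF B] by simp
  qed
  then show ?thesis using that[OF B dB] by blast
qed

end

text \<open>
  The vector \<open>v\<close> is required to be nonzero also when \<open>B\<close> is trivial, so that \<open>span {v}\<close> is a line.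
\<close>

lemma subspace_in_line:
  fixes B :: "'a::euclidean_space set"
  assumes "dim B \<le> 1"
  obtains v where "v \<noteq> 0" "B \<subseteq> span {v}"
proof -
  obtain b where b: "independent b" "B \<subseteq> span b" "card b = dim B" by (rule basis_exists)
  have "finite b" using b(1) by (rule independent_imp_finite)
  obtain e :: 'a where e: "e \<in> Basis" using nonempty_Basis by blast
  consider "b = {}" | v where "b = {v}"
    using assms b(3) \<open>finite b\<close> by (metis card_0_eq card_1_singletonE le_Suc_eq le_zero_eq One_nat_def)
  then show ?thesis
  proof cases
    case 1
    have "B \<subseteq> span {e}" using b(2) 1 by (auto simp: span_zero)
    then show ?thesis using that[of e] e by (auto simp: nonzero_Basis)
  next
    case (2 v)
    have "v \<noteq> 0" using b(1) 2 by (metis dependent_zero insertI1)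
    then show ?thesis using that[of v] b(2) 2 by simp
  qed
qed

theorem theorem6p3p1:
  fixes M :: "('a, 'e::euclidean_space) riem"
    and N :: "('a, 'n::euclidean_space) riem"
    and I :: "real set"
    and \<alpha> :: "real \<Rightarrow> 'a"
    and nf :: "'m::finite \<Rightarrow> real \<Rightarrow> ('a, 'e) tvec"
    and \<kappa> :: "real \<Rightarrow> real ^ 'm"
  assumes "riemannian_manifold M"
    and "riemannian_submanifold N M"
    and "totally_geodesic N M"
    and "DIM('e) = CARD('m) + 1"
    and "C2_curve N I \<alpha>"
    and "rotation_minimizing_frame M I \<alpha> nf \<kappa>"
  shows "(DIM('n) \<le> 2 \<longrightarrow> (\<exists>v. v \<noteq> 0 \<and> (\<forall>s\<in>I. \<kappa> s \<in> span {v}))) \<and>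
         (DIM('n) \<le> CARD('m) \<longrightarrow> (\<exists>a. a \<noteq> 0 \<and> (\<forall>s\<in>I. (\<Sum>i\<in>UNIV. a $ i * \<kappa> s $ i) = 0)))"
proof -
  interpret frame_in_submanifold M N I \<alpha> nf \<kappa>
    by standard (fact assms)+
  obtain B :: "(real ^ 'm) set" where B: "subspace B" "dim B \<le> DIM('n) - 1" "\<And>s. s \<in> I \<Longrightarrow> \<kappa> s \<in> B"
    using normal_development_in_subspace by blast
  show ?thesis
  proof (intro conjI impI)
    assume "DIM('n) \<le> 2"
    with B(2) have "dim B \<le> 1" by linarith
    then obtain v where "v \<noteq> 0" "B \<subseteq> span {v}" by (rule subspace_in_line)
    then show "\<exists>v. v \<noteq> 0 \<and> (\<forall>s\<in>I. \<kappa> s \<in> span {v})" using B(3) by blast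
  next
    assume "DIM('n) \<le> CARD('m)"
    moreover have "0 < DIM('n)" by simp
    ultimately have "dim B < CARD('m)" using B(2) by linarith
    then have "dim B < DIM(real ^ 'm)" by simp
    then obtain a where "a \<noteq> 0" "span B \<subseteq> {x. a \<bullet> x = 0}"
      using lowdim_subset_hyperplane by blast
    then show "\<exists>a. a \<noteq> 0 \<and> (\<forall>s\<in>I. (\<Sum>i\<in>UNIV. a $ i * \<kappa> s $ i) = 0)"
      using B(3) span_superset[of B] by (auto simp: inner_vec_def)
  qed
qed

end
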